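(* Let $\mathbf{V}^*$ be any stationary point (KKT point) of the weighted sum-rate maximization problem $$\text{maximize}_{\mathbf{V}}\ \sum_{k=1}^K \omega_k R_k(\mathbf{V})\quad\text{subject to}\quad \|\mathbf{V}^{(c)}\|_F^2\le P_c,\quad c=1,\dots,C.$$ Then every power constraint is tight at $\mathbf{V}^*$, i.e. $$\|(\mathbf{V}^{(c)})^*\|_F^2=P_c\qquad\text{for all } c=1,\dots,C.$$
   Context: Setting. Positive integers $K$ (users), $C$ (antenna clusters), $L$ (antennas per cluster), $N_r$ (receive antennas per user), $N_t=LC$, and $d_k\le\min\{N_t,N_r\}$ (streams of user $k$), $1\le k\le K$. Constants $\omega_k>0$ (rate weights), $\sigma_k^2>0$ (noise powers), $P_c>0$ (cluster power budgets). Channels $\mathbf{H}_k^{(c)}\in\mathbb{C}^{N_r\times L}$. Put $\mathbf{H}_k=[\mathbf{H}_k^{(1)},\dots,\mathbf{H}_k^{(C)}]\in\mathbb{C}^{N_r\times N_t}$ and let $\mathbf{H}^{(c)}\in\mathbb{C}^{KN_r\times L}$ be the vertical stack of $\mathbf{H}_1^{(c)},\dots,\mathbf{H}_K^{(c)}$. Standing assumption: $\mathbf{H}^{(c)}$ has full row rank, $\operatorname{rank}(\mathbf{H}^{(c)})=KN_r$, for every $c$. Beamformers $\mathbf{V}_k^{(c)}\in\mathbb{C}^{L\times d_k}$. $\mathbf{V}_k\in\mathbb{C}^{N_t\times d_k}$ is the vertical stack of $\mathbf{V}_k^{(1)},\dots,\mathbf{V}_k^{(C)}$; $\mathbf{V}^{(c)}=[\mathbf{V}_1^{(c)},\dots,\mathbf{V}_K^{(c)}]\in\mathbb{C}^{L\times\sum_k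 d_k}$; $\mathbf{V}$ denotes the collection of all blocks. Rates: $R_k(\mathbf{V})=\log\det(\mathbf{I}+\mathbf{V}_k^{\mathrm H}\mathbf{H}_k^{\mathrm H}\mathbf{F}_k^{-1}\mathbf{H}_k\mathbf{V}_k)$ with $\mathbf{F}_k=\sigma_k^2\mathbf{I}+\sum_{j\ne k}\mathbf{H}_k\mathbf{V}_j\mathbf{V}_j^{\mathrm H}\mathbf{H}_k^{\mathrm H}$. Here $^{\mathrm H}$ is conjugate transpose and $\|\cdot\|_F$ the Frobenius norm. Stationary point: with $f=-\sum_k\omega_kR_k$, $\mathbf{V}^*$ is a stationary (KKT) point if there are $\mu_c\ge0$ such that for all $c$: $\nabla_{\mathbf{V}^{(c)}}f(\mathbf{V}^* )+\mu_c(\mathbf{V}^{(c)})^*=\mathbf{0}$, $\mu_c(\|(\mathbf{V}^{(c)})^*\|_F^2-P_c)=0$, and $\|(\mathbf{V}^{(c)})^*\|_F^2\le P_c$. Here $(\mathbf{V}^{(c)})^*$ is the $c$-th cluster block of $\mathbf{V}^*$, and $\nabla$ is the gradient of the real-valued function $f$ with respect to the complex matrix variable (Wirtinger gradient).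
   Formalization: The formal theorem additionally assumes that the weighted sum rate at V* is nonzero; as stated the claim fails, since V* = 0 satisfies all KKT conditions with every μ_c = 0 while every power constraint is slack. *)

theory Defs
  imports
    "HOL-Analysis.Analysis"
    "Jordan_Normal_Form.Schur_Decomposition"
    "Jordan_Normal_Form.DL_Rank"
begin

text \<open>
  Users are \<open>0, ..., K - 1\<close> and clusters \<open>0, ..., C - 1\<close>. The channel block of user \<open>k\<close> and
  cluster \<open>c\<close> is \<open>H k c\<close> (of size \<open>Nr \<times> L\<close>), the beamformer block is \<open>V k c\<close> (of size \<open>L \<times> d k\<close>).
  Values of \<open>H\<close>, \<open>V\<close>, \<open>d\<close>, ... at indices out of range are irrelevant.
\<close>

definition append_cols :: "'a :: zero mat \<Rightarrow> 'a mat \<Rightarrow> 'a mat" where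
  "append_cols A B = four_block_mat A B (0\<^sub>m 0 (dim_col A)) (0\<^sub>m 0 (dim_col B))"

definition hcat :: "nat \<Rightarrow> 'a :: zero mat list \<Rightarrow> 'a mat" where
  "hcat nr As = foldr append_cols As (0\<^sub>m nr 0)"

definition vcat :: "nat \<Rightarrow> 'a :: zero mat list \<Rightarrow> 'a mat" where
  "vcat nc As = foldr append_rows As (0\<^sub>m 0 nc)"

definition mat_sum :: "nat \<Rightarrow> nat \<Rightarrow> ('i \<Rightarrow> 'a :: comm_monoid_add mat) \<Rightarrow> 'i set \<Rightarrow> 'a mat" where
  "mat_sum nr nc A I = mat nr nc (\<lambda>ij. \<Sum>i\<in>I. A i $$ ij)"

definition frob_norm_sq :: "complex mat \<Rightarrow> real" where
  "frob_norm_sq A = (\<Sum>i<dim_row A. \<Sum>j<dim_col A. (cmod (A $$ (i, j)))\<^sup>2)"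

definition user_channel :: "nat \<Rightarrow> nat \<Rightarrow> (nat \<Rightarrow> nat \<Rightarrow> complex mat) \<Rightarrow> nat \<Rightarrow> complex mat" where
  "user_channel C Nr H k = hcat Nr (map (\<lambda>c. H k c) [0..<C])"

definition cluster_channel :: "nat \<Rightarrow> nat \<Rightarrow> (nat \<Rightarrow> nat \<Rightarrow> complex mat) \<Rightarrow> nat \<Rightarrow> complex mat" where
  "cluster_channel K L H c = vcat L (map (\<lambda>k. H k c) [0..<K])"

definition user_beam :: "nat \<Rightarrow> (nat \<Rightarrow> nat) \<Rightarrow> (nat \<Rightarrow> nat \<Rightarrow> complex mat) \<Rightarrow> nat \<Rightarrow> complex mat" where
  "user_beam C d V k = vcat (d k) (map (\<lambda>c. V k c) [0..<C])"

definition cluster_beam :: "nat \<Rightarrow> nat \<Rightarrow> (nat \<Rightarrow> nat \<Rightarrow> complex mat) \<Rightarrow> nat \<Rightarrow> complex mat" where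
  "cluster_beam K L V c = hcat L (map (\<lambda>k. V k c) [0..<K])"

definition interference ::
  "nat \<Rightarrow> nat \<Rightarrow> nat \<Rightarrow> (nat \<Rightarrow> nat) \<Rightarrow> (nat \<Rightarrow> real) \<Rightarrow> (nat \<Rightarrow> nat \<Rightarrow> complex mat) \<Rightarrow>
    (nat \<Rightarrow> nat \<Rightarrow> complex mat) \<Rightarrow> nat \<Rightarrow> complex mat" where
  "interference K C Nr d \<sigma> H V k =
     complex_of_real ((\<sigma> k)\<^sup>2) \<cdot>\<^sub>m 1\<^sub>m Nr +
     mat_sum Nr Nr
       (\<lambda>j. user_channel C Nr H k * user_beam C d V j *
            mat_adjoint (user_beam C d V j) * mat_adjoint (user_channel C Nr H k))
       ({..<K} - {k})"

text \<open>
  The interference-plus-noise matrix is Hermitian positive definite (as \<open>\<sigma> k \<noteq> 0\<close>), so its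
  inverse exists and the determinant below is a real number \<open>\<ge> 1\<close>; \<open>Re\<close> only changes its type.
\<close>

definition rate ::
  "nat \<Rightarrow> nat \<Rightarrow> nat \<Rightarrow> (nat \<Rightarrow> nat) \<Rightarrow> (nat \<Rightarrow> real) \<Rightarrow> (nat \<Rightarrow> nat \<Rightarrow> complex mat) \<Rightarrow>
    (nat \<Rightarrow> nat \<Rightarrow> complex mat) \<Rightarrow> nat \<Rightarrow> real" where
  "rate K C Nr d \<sigma> H V k =
     ln (Re (det (1\<^sub>m (d k) +
       mat_adjoint (user_beam C d V k) * mat_adjoint (user_channel C Nr H k) *
       the (mat_inverse (interference K C Nr d \<sigma> H V k)) *
       user_channel C Nr H k * user_beam C d V k)))"

definition weighted_sum_rate ::
  "nat \<Rightarrow> nat \<Rightarrow> nat \<Rightarrow> (nat \<Rightarrow> nat) \<Rightarrow> (nat \<Rightarrow> real) \<Rightarrow> (nat \<Rightarrow> real) \<Rightarrow>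
    (nat \<Rightarrow> nat \<Rightarrow> complex mat) \<Rightarrow> (nat \<Rightarrow> nat \<Rightarrow> complex mat) \<Rightarrow> real" where
  "weighted_sum_rate K C Nr d \<omega> \<sigma> H V = (\<Sum>k<K. \<omega> k * rate K C Nr d \<sigma> H V k)"

definition perturb ::
  "(nat \<Rightarrow> nat \<Rightarrow> complex mat) \<Rightarrow> nat \<Rightarrow> nat \<Rightarrow> nat \<times> nat \<Rightarrow> complex \<Rightarrow> (nat \<Rightarrow> nat \<Rightarrow> complex mat)" where
  "perturb V k c ij z = V(k := (V k)(c :=
     V k c + z \<cdot>\<^sub>m mat (dim_row (V k c)) (dim_col (V k c)) (\<lambda>ab. if ab = ij then 1 else 0)))"

text \<open>
  Entrywise \<open>\<partial>f/\<partial>cnj z = (\<partial>f/\<partial>x + \<i> \<partial>f/\<partial>y) / 2\<close> for an entry \<open>z = x + \<i> y\<close> of the block \<open>V k c\<close>.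
\<close>

definition wirtinger_block ::
  "((nat \<Rightarrow> nat \<Rightarrow> complex mat) \<Rightarrow> real) \<Rightarrow> (nat \<Rightarrow> nat \<Rightarrow> complex mat) \<Rightarrow> nat \<Rightarrow> nat \<Rightarrow> complex mat" where
  "wirtinger_block f V k c = mat (dim_row (V k c)) (dim_col (V k c)) (\<lambda>ij.
     (complex_of_real (deriv (\<lambda>t. f (perturb V k c ij (complex_of_real t))) 0) +
      \<i> * complex_of_real (deriv (\<lambda>t. f (perturb V k c ij (\<i> * complex_of_real t))) 0)) / 2)"

definition wirtinger_gradient ::
  "nat \<Rightarrow> nat \<Rightarrow> ((nat \<Rightarrow> nat \<Rightarrow> complex mat) \<Rightarrow> real) \<Rightarrow> (nat \<Rightarrow> nat \<Rightarrow> complex mat) \<Rightarrow> nat \<Rightarrow> complex mat" where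
  "wirtinger_gradient K L f V c = hcat L (map (\<lambda>k. wirtinger_block f V k c) [0..<K])"

definition stationary_point ::
  "nat \<Rightarrow> nat \<Rightarrow> nat \<Rightarrow> nat \<Rightarrow> (nat \<Rightarrow> nat) \<Rightarrow> (nat \<Rightarrow> real) \<Rightarrow> (nat \<Rightarrow> real) \<Rightarrow> (nat \<Rightarrow> real) \<Rightarrow>
    (nat \<Rightarrow> nat \<Rightarrow> complex mat) \<Rightarrow> (nat \<Rightarrow> nat \<Rightarrow> complex mat) \<Rightarrow> bool" where
  "stationary_point K C L Nr d \<omega> \<sigma> P H V \<longleftrightarrow>
     (\<exists>\<mu> :: nat \<Rightarrow> real. \<forall>c<C.
        \<mu> c \<ge> 0 \<and>
        wirtinger_gradient K L (\<lambda>W. - weighted_sum_rate K C Nr d \<omega> \<sigma> H W) V c +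
          complex_of_real (\<mu> c) \<cdot>\<^sub>m cluster_beam K L V c = 0\<^sub>m L (\<Sum>k<K. d k) \<and>
        \<mu> c * (frob_norm_sq (cluster_beam K L V c) - P c) = 0 \<and>
        frob_norm_sq (cluster_beam K L V c) \<le> P c)"

lemma append_cols_carrier: "A \<in> carrier_mat n a \<Longrightarrow> B \<in> carrier_mat n b \<Longrightarrow> append_cols A B \<in> carrier_mat n (a + b)"
  unfolding append_cols_def by auto

lemma append_cols_0: "append_cols (0\<^sub>m n a) (0\<^sub>m n b) = 0\<^sub>m n (a + b)"
  unfolding append_cols_def by (intro eq_matI) (auto simp: four_block_mat_def Let_def)

lemma hcat_0: "hcat n (map (\<lambda>k. 0\<^sub>m n (d k)) ks) = 0\<^sub>m n (sum_list (map d ks))"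
  by (induction ks) (auto simp: hcat_def append_cols_0)

lemma hcat_carrier: "(\<And>A. A \<in> set As \<Longrightarrow> A \<in> carrier_mat n m) \<Longrightarrow> hcat n As \<in> carrier_mat n (m * length As)"
proof (induction As)
  case Nil then show ?case by (simp add: hcat_def)
next
  case (Cons A As)
  have "append_cols A (hcat n As) \<in> carrier_mat n (m + m * length As)"
    by (rule append_cols_carrier) (use Cons in auto)
  then show ?case by (simp add: hcat_def)
qed

lemma vcat_carrier: "(\<And>A. A \<in> set As \<Longrightarrow> A \<in> carrier_mat m n) \<Longrightarrow> vcat n As \<in> carrier_mat (m * length As) n"
proof (induction As)
  case Nil then show ?case by (simp add: vcat_def)
next
  case (Cons A As)
  have "A @\<^sub>r (vcat n As) \<in> carrier_mat (m + m * length As) n"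
    by (rule carrier_append_rows) (use Cons in auto)
  then show ?case by (simp add: vcat_def)
qed

lemma append_rows_smult:
  fixes z :: complex
  assumes "A \<in> carrier_mat a n" "B \<in> carrier_mat b n"
  shows "(z \<cdot>\<^sub>m A) @\<^sub>r (z \<cdot>\<^sub>m B) = z \<cdot>\<^sub>m (A @\<^sub>r B)"
  using assms by (intro eq_matI) (auto simp: append_rows_def four_block_mat_def Let_def)

lemma vcat_smult:
  fixes z :: complex
  assumes "\<And>i. i \<in> set is \<Longrightarrow> A i \<in> carrier_mat m n"
  shows "vcat n (map (\<lambda>i. z \<cdot>\<^sub>m A i) is) = z \<cdot>\<^sub>m vcat n (map A is)"
  using assms
proof (induction "is")
  case Nil then show ?case by (auto simp: vcat_def intro!: eq_matI)
next
  case (Cons i "is")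
  have "vcat n (map A is) \<in> carrier_mat (m * length (map A is)) n"
    by (rule vcat_carrier) (use Cons in auto)
  moreover have "A i \<in> carrier_mat m n" using Cons by auto
  moreover have "vcat n (map (\<lambda>i. z \<cdot>\<^sub>m A i) is) = z \<cdot>\<^sub>m vcat n (map A is)"
    using Cons by auto
  ultimately show ?case using append_rows_smult[of "A i" m n "vcat n (map A is)" _ z]
    by (simp add: vcat_def)
qed

lemma mat_adjoint_carrier: "A \<in> carrier_mat n m \<Longrightarrow> mat_adjoint A \<in> carrier_mat m n"
  for A :: "complex mat"
  unfolding mat_adjoint_def by (auto simp: mat_of_rows_def)

lemma mat_adjoint_smult: 
  fixes A :: "complex mat"
  shows "mat_adjoint (z \<cdot>\<^sub>m A) = cnj z \<cdot>\<^sub>m mat_adjoint A"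
  unfolding mat_adjoint_def by (intro eq_matI) (auto simp: mat_of_rows_def)

lemma mat_inverse_scalar:
  assumes "s \<noteq> (0::complex)"
  shows "the (mat_inverse (s \<cdot>\<^sub>m 1\<^sub>m n)) \<in> carrier_mat n n"
proof (cases "mat_inverse (s \<cdot>\<^sub>m 1\<^sub>m n)")
  case None
  have "s \<cdot>\<^sub>m 1\<^sub>m n \<notin> Units (ring_mat TYPE(complex) n ())"
    by (rule mat_inverse(1)[OF _ None]) auto
  moreover have "s \<cdot>\<^sub>m 1\<^sub>m n \<in> Units (ring_mat TYPE(complex) n ())"
    unfolding Units_def
    by (auto simp: ring_mat_def intro!: bexI[of _ "inverse s \<cdot>\<^sub>m 1\<^sub>m n"])
      (use assms in \<open>auto intro!: eq_matI\<close>)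
  ultimately show ?thesis by simp
next
  case (Some B)
  then show ?thesis using mat_inverse(2)[OF _ Some, of n] by auto
qed

lemma deriv_ln_det_0:
  fixes G :: "complex mat"
  assumes G: "G \<in> carrier_mat n n"
  shows "((\<lambda>t::real. ln (Re (det (1\<^sub>m n + complex_of_real (t\<^sup>2) \<cdot>\<^sub>m G)))) has_real_derivative 0) (at 0)"
proof -
  define q where "q s = det (1\<^sub>m n + s \<cdot>\<^sub>m G)" for s
  have *: "q s = (\<Sum>p | p permutes {0..<n}. signof p * (\<Prod>i = 0..<n. (if i = p i then 1 else 0) + s * G $$ (i, p i)))" for s
  proof -
    have "q s = (\<Sum>p | p permutes {0..<n}. signof p * (\<Prod>i = 0..<n. (1\<^sub>m n + s \<cdot>\<^sub>m G) $$ (i, p i)))"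
      unfolding q_def by (rule det_def') (use G in auto)
    also have "\<dots> = (\<Sum>p | p permutes {0..<n}. signof p * (\<Prod>i = 0..<n. (if i = p i then 1 else 0) + s * G $$ (i, p i)))"
    proof (intro sum.cong refl arg_cong2[where f = "(*)"] prod.cong)
      fix p i assume p: "p \<in> {p. p permutes {0..<n}}" and i: "i \<in> {0..<n}"
      then have "p i < n" using permutes_in_image[of p "{0..<n}" i] by auto
      then show "(1\<^sub>m n + s \<cdot>\<^sub>m G) $$ (i, p i) = (if i = p i then 1 else 0) + s * G $$ (i, p i)"
        using i G by auto
    qed
    finally show ?thesis .
  qed
  have "q holomorphic_on UNIV"
    unfolding * by (intro holomorphic_intros)
  then obtain D where D: "(q has_field_derivative D) (at 0)"
    by (metis UNIV_I open_UNIV holomorphic_on_imp_differentiable_at field_differentiable_def)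
  have "1\<^sub>m n + 0 \<cdot>\<^sub>m G = 1\<^sub>m n" using G by (intro eq_matI) auto
  then have q0: "q 0 = 1" unfolding q_def by simp
  have r: "((\<lambda>t. q (complex_of_real t)) has_vector_derivative D) (at 0)"
    using has_vector_derivative_real_field[of q D 0 UNIV] D by simp
  then have r: "((\<lambda>t. Re (q (complex_of_real t))) has_real_derivative Re D) (at 0)"
    using bounded_linear.has_vector_derivative[OF bounded_linear_Re r]
    by (simp add: has_real_derivative_iff_has_vector_derivative)
  have "((\<lambda>t::real. t\<^sup>2) has_real_derivative 0) (at 0)"
    by (auto intro!: derivative_eq_intros)
  then have "((\<lambda>t. Re (q (complex_of_real (t\<^sup>2)))) has_real_derivative Re D * 0) (at 0)"
    using DERIV_chain2[of "\<lambda>t. Re (q (complex_of_real t))" "Re D" "\<lambda>t. t\<^sup>2" 0 0 UNIV] r by simp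
  from DERIV_chain2[OF DERIV_ln this] q0
  show ?thesis by (simp add: q_def)
qed


lemma user_channel_carrier:
  assumes "\<And>c. c < C \<Longrightarrow> H k c \<in> carrier_mat Nr L"
  shows "user_channel C Nr H k \<in> carrier_mat Nr (L * C)"
proof -
  have "\<And>A. A \<in> set (map (\<lambda>c. H k c) [0..<C]) \<Longrightarrow> A \<in> carrier_mat Nr L" using assms by auto
  from hcat_carrier[of "map (\<lambda>c. H k c) [0..<C]", OF this] show ?thesis by (simp add: user_channel_def)
qed

lemma user_beam_carrier:
  assumes "\<And>c. c < C \<Longrightarrow> W k c \<in> carrier_mat L (d k)"
  shows "user_beam C d W k \<in> carrier_mat (L * C) (d k)"
proof -
  have "\<And>A. A \<in> set (map (\<lambda>c. W k c) [0..<C]) \<Longrightarrow> A \<in> carrier_mat L (d k)" using assms by auto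
  from vcat_carrier[of "map (\<lambda>c. W k c) [0..<C]", OF this] show ?thesis by (simp add: user_beam_def)
qed

lemma user_beam_smult:
  assumes "\<And>c. c < C \<Longrightarrow> W k c \<in> carrier_mat L (d k)"
  shows "user_beam C d (\<lambda>k c. z \<cdot>\<^sub>m W k c) k = z \<cdot>\<^sub>m user_beam C d W k"
  unfolding user_beam_def using assms by (intro vcat_smult) auto

lemma user_beam_0:
  assumes "\<And>c. c < C \<Longrightarrow> W k c = 0\<^sub>m L (d k)"
  shows "user_beam C d W k = 0\<^sub>m (L * C) (d k)"
proof -
  have W: "W k c \<in> carrier_mat L (d k)" if "c < C" for c using assms that by simp
  have "map (\<lambda>c. W k c) [0..<C] = map (\<lambda>c. 0 \<cdot>\<^sub>m W k c) [0..<C]" using assms by auto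
  then have "user_beam C d W k = user_beam C d (\<lambda>k c. 0 \<cdot>\<^sub>m W k c) k"
    unfolding user_beam_def by (rule arg_cong)
  also have "\<dots> = 0 \<cdot>\<^sub>m user_beam C d W k" by (rule user_beam_smult) (rule W)
  also have "\<dots> = 0\<^sub>m (L * C) (d k)"
    using user_beam_carrier[where W = W and k = k and C = C and d = d and L = L] W by (intro eq_matI) auto
  finally show ?thesis .
qed

lemma interference_single:
  assumes H: "\<And>k c. k < K \<Longrightarrow> c < C \<Longrightarrow> H k c \<in> carrier_mat Nr L" and k: "k < K"
    and W: "\<And>j c. j < K \<Longrightarrow> j \<noteq> k \<Longrightarrow> c < C \<Longrightarrow> W j c = 0\<^sub>m L (d j)"
  shows "interference K C Nr d \<sigma> H W k = complex_of_real ((\<sigma> k)\<^sup>2) \<cdot>\<^sub>m 1\<^sub>m Nr"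
proof -
  let ?H = "user_channel C Nr H k"
  have Hk: "?H \<in> carrier_mat Nr (L * C)" using user_channel_carrier H k by blast
  have "?H * user_beam C d W j * mat_adjoint (user_beam C d W j) * mat_adjoint ?H = 0\<^sub>m Nr Nr"
    if "j \<in> {..<K} - {k}" for j
  proof -
    have B: "user_beam C d W j = 0\<^sub>m (L * C) (d j)" using that W by (intro user_beam_0) auto
    show ?thesis
      using Hk mat_adjoint_carrier[OF Hk] mat_adjoint_carrier[of "0\<^sub>m (L * C) (d j)" "L * C" "d j"]
      unfolding B by simp
  qed
  then have "mat_sum Nr Nr (\<lambda>j. ?H * user_beam C d W j * mat_adjoint (user_beam C d W j) * mat_adjoint ?H)
    ({..<K} - {k}) = 0\<^sub>m Nr Nr"
    unfolding mat_sum_def by (intro eq_matI) (auto intro!: sum.neutral)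
  then show ?thesis unfolding interference_def by simp
qed

lemma rate_deriv_0:
  assumes H: "\<And>k c. k < K \<Longrightarrow> c < C \<Longrightarrow> H k c \<in> carrier_mat Nr L"
    and s: "\<And>k. k < K \<Longrightarrow> (\<sigma> k)\<^sup>2 > 0" and k: "k < K" and k': "k' < K"
    and W: "\<And>j c. W j c \<in> carrier_mat L (d j)"
    and W0: "\<And>j c. j \<noteq> k \<Longrightarrow> W j c = 0\<^sub>m L (d j)"
    and u: "cnj u * u = 1"
  shows "((\<lambda>t::real. rate K C Nr d \<sigma> H (\<lambda>k c. (u * complex_of_real t) \<cdot>\<^sub>m W k c) k') has_real_derivative 0) (at 0)"
proof (cases "k' = k")
  case False
  have B: "user_beam C d (\<lambda>k c. z \<cdot>\<^sub>m W k c) k' = 0\<^sub>m (L * C) (d k')" for z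
    by (rule user_beam_0) (use W0 False in auto)
  have *: "A * 0\<^sub>m (L * C) (d k') = 0\<^sub>m (dim_row A) (d k')" for A :: "complex mat"
    by (intro eq_matI) (auto simp: scalar_prod_def)
  have "dim_row (mat_adjoint (0\<^sub>m (L * C) (d k') :: complex mat)) = d k'"
    using mat_adjoint_carrier[of "0\<^sub>m (L * C) (d k')" "L * C" "d k'"] by auto
  then have "rate K C Nr d \<sigma> H (\<lambda>k c. z \<cdot>\<^sub>m W k c) k' = 0" for z
    unfolding rate_def B * by simp
  then show ?thesis by simp
next
  case True
  let ?H = "user_channel C Nr H k" and ?B = "user_beam C d W k"
  let ?X = "the (mat_inverse (complex_of_real ((\<sigma> k)\<^sup>2) \<cdot>\<^sub>m 1\<^sub>m Nr))"
  let ?G = "mat_adjoint ?B * mat_adjoint ?H * ?X * ?H * ?B"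
  have c: "?H \<in> carrier_mat Nr (L * C)" "?B \<in> carrier_mat (L * C) (d k)" 
    "?X \<in> carrier_mat Nr Nr"
    using user_channel_carrier H k user_beam_carrier W apply blast
    using user_beam_carrier W apply blast
    using mat_inverse_scalar[of "complex_of_real ((\<sigma> k)\<^sup>2)" Nr] s[OF k] by simp
  note c = c mat_adjoint_carrier[OF c(1)] mat_adjoint_carrier[OF c(2)]
  have A: "mat_adjoint ?B * mat_adjoint ?H * ?X * ?H \<in> carrier_mat (d k) (L * C)"
    using c by auto
  have G: "?G \<in> carrier_mat (d k) (d k)" using c by auto
  have F: "interference K C Nr d \<sigma> H (\<lambda>k c. z \<cdot>\<^sub>m W k c) k = complex_of_real ((\<sigma> k)\<^sup>2) \<cdot>\<^sub>m 1\<^sub>m Nr" for z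
    by (rule interference_single[OF H k]) (use W0 in auto)
  have B: "user_beam C d (\<lambda>k c. z \<cdot>\<^sub>m W k c) k = z \<cdot>\<^sub>m ?B" for z
    by (rule user_beam_smult) (rule W)
  have *: "mat_adjoint (z \<cdot>\<^sub>m ?B) * mat_adjoint ?H * ?X * ?H * (z \<cdot>\<^sub>m ?B) = (cnj z * z) \<cdot>\<^sub>m ?G" for z
  proof -
    have "mat_adjoint (z \<cdot>\<^sub>m ?B) * mat_adjoint ?H * ?X * ?H = cnj z \<cdot>\<^sub>m (mat_adjoint ?B * mat_adjoint ?H * ?X * ?H)"
      unfolding mat_adjoint_smult
      by (simp only: mult_smult_assoc_mat[OF c(5) c(4)]
        mult_smult_assoc_mat[OF mult_carrier_mat[OF c(5) c(4)] c(3)]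
        mult_smult_assoc_mat[OF mult_carrier_mat[OF mult_carrier_mat[OF c(5) c(4)] c(3)] c(1)])
    moreover have "cnj z \<cdot>\<^sub>m (mat_adjoint ?B * mat_adjoint ?H * ?X * ?H) * (z \<cdot>\<^sub>m ?B) = cnj z \<cdot>\<^sub>m (z \<cdot>\<^sub>m ?G)"
      by (subst mult_smult_assoc_mat[OF A, of "z \<cdot>\<^sub>m ?B"])
        (use c in \<open>auto simp: mult_smult_distrib[OF A c(2)]\<close>)
    ultimately show ?thesis by (auto intro!: eq_matI)
  qed
  have u': "cnj (u * complex_of_real t) * (u * complex_of_real t) = complex_of_real (t\<^sup>2)" for t
    using u by (simp add: power2_eq_square algebra_simps)
  show ?thesis
    unfolding True rate_def F B * u' by (rule deriv_ln_det_0[OF G])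
qed

lemma wsr_deriv_0:
  assumes H: "\<And>k c. k < K \<Longrightarrow> c < C \<Longrightarrow> H k c \<in> carrier_mat Nr L"
    and s: "\<And>k. k < K \<Longrightarrow> (\<sigma> k)\<^sup>2 > 0" and k: "k < K"
    and u: "cnj u * u = 1"
  shows "deriv (\<lambda>t::real. - weighted_sum_rate K C Nr d \<omega> \<sigma> H
     (perturb (\<lambda>k c. 0\<^sub>m L (d k)) k c ij (u * complex_of_real t))) 0 = 0"
proof -
  define W where "W = (\<lambda>k' c'. if k' = k \<and> c' = c then mat L (d k) (\<lambda>ab. if ab = ij then 1 else 0)
    else (0\<^sub>m L (d k') :: complex mat))"
  have p: "perturb (\<lambda>k c. 0\<^sub>m L (d k)) k c ij z = (\<lambda>k c. z \<cdot>\<^sub>m W k c)" for z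
    unfolding perturb_def W_def by (intro ext eq_matI) auto
  have "((\<lambda>t::real. - (\<Sum>k<K. \<omega> k * rate K C Nr d \<sigma> H (\<lambda>k c. (u * complex_of_real t) \<cdot>\<^sub>m W k c) k))
    has_real_derivative - (\<Sum>k<K. \<omega> k * 0)) (at 0)"
    by (intro DERIV_minus DERIV_sum DERIV_cmult rate_deriv_0[OF H s k _ _ _ u])
       (auto simp: W_def)
  then show ?thesis unfolding p weighted_sum_rate_def by (simp add: DERIV_imp_deriv)
qed

text \<open>
  The zero beamformer is stationary (with all multipliers zero) although every power constraint
  is slack there. Tightness of the constraints can hence only be claimed for stationary points
  that are not degenerate in this way, i.e. whose weighted sum rate is nonzero.
\<close>

lemma zero_beamformer_stationary_not_tight:
  assumes H: "\<And>k c. k < K \<Longrightarrow> c < C \<Longrightarrow> H k c \<in> carrier_mat Nr L"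
    and s: "\<And>k. k < K \<Longrightarrow> (\<sigma> k)\<^sup>2 > 0"
    and P: "\<And>c. c < C \<Longrightarrow> P c > 0"
  shows "stationary_point K C L Nr d \<omega> \<sigma> P H (\<lambda>k c. 0\<^sub>m L (d k))"
    and "c < C \<Longrightarrow> frob_norm_sq (cluster_beam K L (\<lambda>k c. 0\<^sub>m L (d k)) c) \<noteq> P c"
proof -
  let ?Z = "\<lambda>k c. 0\<^sub>m L (d k) :: complex mat" and ?f = "\<lambda>W. - weighted_sum_rate K C Nr d \<omega> \<sigma> H W"
  have sl: "sum_list (map d [0..<K]) = (\<Sum>k<K. d k)"
    by (simp add: sum_list_distinct_conv_sum_set atLeast0LessThan)
  have cb: "cluster_beam K L ?Z c = 0\<^sub>m L (\<Sum>k<K. d k)" for c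
    unfolding cluster_beam_def using hcat_0[of L d "[0..<K]"] sl by simp
  have fz: "frob_norm_sq (cluster_beam K L ?Z c) = 0" for c
    unfolding cb frob_norm_sq_def by simp
  have "wirtinger_block ?f ?Z k c = 0\<^sub>m L (d k)" if "k < K" for k c
    unfolding wirtinger_block_def
    using wsr_deriv_0[where H = H and \<sigma> = \<sigma> and K = K and C = C and Nr = Nr and u = 1, OF H s that]
      wsr_deriv_0[where H = H and \<sigma> = \<sigma> and K = K and C = C and Nr = Nr and u = \<i>, OF H s that]
    by (intro eq_matI) auto
  then have "map (\<lambda>k. wirtinger_block ?f ?Z k c) [0..<K] = map (\<lambda>k. 0\<^sub>m L (d k)) [0..<K]" for c
    by auto
  then have gz: "wirtinger_gradient K L ?f ?Z c = 0\<^sub>m L (\<Sum>k<K. d k)" for c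
    unfolding wirtinger_gradient_def using hcat_0[of L d "[0..<K]"] sl by (simp only:)
  show "stationary_point K C L Nr d \<omega> \<sigma> P H ?Z"
    unfolding stationary_point_def gz fz unfolding cb
    using P by (intro exI[of _ "\<lambda>_. 0"]) (auto simp: less_imp_le intro!: eq_matI)
  show "c < C \<Longrightarrow> frob_norm_sq (cluster_beam K L ?Z c) \<noteq> P c"
    using P[of c] by (simp add: fz)
qed

end

theory Submission
  imports Defs
begin

text \<open>
  If the constraint of cluster \<open>c\<close> is slack, then its multiplier vanishes, so the gradient of the
  weighted sum rate with respect to the beamformers of cluster \<open>c\<close> vanishes. Pick a user \<open>k\<close> with
  nonzero rate. As the stacked channel of cluster \<open>c\<close> has full row rank, there is a change \<open>\<Delta>\<close> of
  the block \<open>V k c\<close> that is invisible to all users except \<open>k\<close>, and that user \<open>k\<close> receives as a copy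
  of its own signal. Moving along \<open>t \<cdot> \<Delta>\<close> only affects the rate of user \<open>k\<close>, which becomes
  \<open>\<Sum>l ln (1 + (1 + t)\<^sup>2 l)\<close> with \<open>l\<close> ranging over the nonnegative eigenvalues of its signal to
  interference matrix. These are not all zero, so the derivative at \<open>t = 0\<close> is positive, although
  the directional derivative of a function with vanishing gradient is zero.
\<close>

subsection \<open>Directional differentiability in complex variables\<close>

text \<open>
  Differentiability at the origin along every line, with a derivative that is real-linear in the
  direction (\<open>\<alpha>\<close> and \<open>\<beta>\<close> are the two families of Wirtinger derivatives). This is weaker than
  Frechet differentiability, but it is stable under all operations that build the rates, and it
  suffices to pass from vanishing partial derivatives to vanishing directional derivatives.
\<close>

definition wdiff :: "'i set \<Rightarrow> (('i \<Rightarrow> complex) \<Rightarrow> complex) \<Rightarrow> bool" where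
  "wdiff I \<phi> \<longleftrightarrow> (\<exists>\<alpha> \<beta>. \<forall>X.
     ((\<lambda>t. \<phi> (\<lambda>i. of_real t * X i)) has_vector_derivative (\<Sum>i\<in>I. \<alpha> i * X i + \<beta> i * cnj (X i))) (at 0))"

lemma wdiff_const: "wdiff I (\<lambda>X. a)"
  unfolding wdiff_def by (intro exI[of _ "\<lambda>_. 0"]) auto

lemma wdiff_coord:
  assumes "finite I" "p \<in> I"
  shows "wdiff I (\<lambda>X. X p)"
  unfolding wdiff_def
proof (intro exI allI)
  fix X :: "'a \<Rightarrow> complex"
  have "(\<Sum>i\<in>I. (if i = p then 1 else 0) * X i + 0 * cnj (X i)) = (\<Sum>i\<in>I. if i = p then X i else 0)"
    by (intro sum.cong) auto
  also have "\<dots> = X p" using assms by simp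
  finally have eq: "(\<Sum>i\<in>I. (if i = p then 1 else 0) * X i + 0 * cnj (X i)) = X p" .
  have "((\<lambda>t. of_real t * X p) has_vector_derivative 1 * X p) (at 0)"
    by (intro has_vector_derivative_mult_left) (auto intro!: derivative_eq_intros)
  then show "((\<lambda>t. of_real t * X p) has_vector_derivative
      (\<Sum>i\<in>I. (if i = p then 1 else 0) * X i + 0 * cnj (X i))) (at 0)"
    unfolding eq by simp
qed

lemma wdiff_add:
  assumes "wdiff I \<phi>" "wdiff I \<psi>"
  shows "wdiff I (\<lambda>X. \<phi> X + \<psi> X)"
proof -
  obtain a b where ab: "\<And>X. ((\<lambda>t. \<phi> (\<lambda>i. of_real t * X i)) has_vector_derivative (\<Sum>i\<in>I. a i * X i + b i * cnj (X i))) (at 0)"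
    using assms(1) unfolding wdiff_def by blast
  obtain c d where cd: "\<And>X. ((\<lambda>t. \<psi> (\<lambda>i. of_real t * X i)) has_vector_derivative (\<Sum>i\<in>I. c i * X i + d i * cnj (X i))) (at 0)"
    using assms(2) unfolding wdiff_def by blast
  show ?thesis unfolding wdiff_def
  proof (intro exI allI)
    fix X
    show "((\<lambda>t. \<phi> (\<lambda>i. of_real t * X i) + \<psi> (\<lambda>i. of_real t * X i)) has_vector_derivative
        (\<Sum>i\<in>I. (a i + c i) * X i + (b i + d i) * cnj (X i))) (at 0)"
      using has_vector_derivative_add[OF ab[of X] cd[of X]]
      by (simp add: sum.distrib algebra_simps)
  qed
qed

text \<open>The product rule. Every line \<open>t * X\<close> passes through the origin at
  \<open>t = 0\<close>, so the values of both factors there are constants that do not depend on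
  \<open>X\<close>, and the derivative stays real-linear in \<open>X\<close>.\<close>

lemma wdiff_mult:
  assumes "wdiff I \<phi>" "wdiff I \<psi>"
  shows "wdiff I (\<lambda>X. \<phi> X * \<psi> X)"
proof -
  obtain a b where ab: "\<And>X. ((\<lambda>t. \<phi> (\<lambda>i. of_real t * X i)) has_vector_derivative (\<Sum>i\<in>I. a i * X i + b i * cnj (X i))) (at 0)"
    using assms(1) unfolding wdiff_def by blast
  obtain c d where cd: "\<And>X. ((\<lambda>t. \<psi> (\<lambda>i. of_real t * X i)) has_vector_derivative (\<Sum>i\<in>I. c i * X i + d i * cnj (X i))) (at 0)"
    using assms(2) unfolding wdiff_def by blast
  let ?f = "\<phi> (\<lambda>_. 0)" and ?g = "\<psi> (\<lambda>_. 0)"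
  show ?thesis unfolding wdiff_def
  proof (intro exI allI)
    fix X
    have "(\<Sum>i\<in>I. (?f * c i + ?g * a i) * X i + (?f * d i + ?g * b i) * cnj (X i)) =
      ?f * (\<Sum>i\<in>I. c i * X i + d i * cnj (X i)) + (\<Sum>i\<in>I. a i * X i + b i * cnj (X i)) * ?g"
      unfolding sum_distrib_left sum_distrib_right sum.distrib[symmetric]
      by (intro sum.cong) (auto simp: algebra_simps)
    then show "((\<lambda>t. \<phi> (\<lambda>i. of_real t * X i) * \<psi> (\<lambda>i. of_real t * X i)) has_vector_derivative
        (\<Sum>i\<in>I. (?f * c i + ?g * a i) * X i + (?f * d i + ?g * b i) * cnj (X i))) (at 0)"
      using has_vector_derivative_mult[OF ab[of X] cd[of X]] by simp
  qed
qed

lemma wdiff_sum: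
  "(\<And>a. a \<in> A \<Longrightarrow> wdiff I (\<phi> a)) \<Longrightarrow> wdiff I (\<lambda>X. \<Sum>a\<in>A. \<phi> a X)"
  by (induction A rule: infinite_finite_induct) (simp_all add: wdiff_const wdiff_add wdiff_mult)

lemma wdiff_prod:
  "(\<And>a. a \<in> A \<Longrightarrow> wdiff I (\<phi> a)) \<Longrightarrow> wdiff I (\<lambda>X. \<Prod>a\<in>A. \<phi> a X)"
  by (induction A rule: infinite_finite_induct) (simp_all add: wdiff_const wdiff_add wdiff_mult)

text \<open>Conjugation exchanges the two coefficient families. This makes adjoints admissible,
  although they are not holomorphic in the entries.\<close>

lemma wdiff_cnj:
  assumes "wdiff I \<phi>"
  shows "wdiff I (\<lambda>X. cnj (\<phi> X))"
proof -
  obtain a b where ab: "\<And>X. ((\<lambda>t. \<phi> (\<lambda>i. of_real t * X i)) has_vector_derivative (\<Sum>i\<in>I. a i * X i + b i * cnj (X i))) (at 0)"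
    using assms(1) unfolding wdiff_def by blast
  show ?thesis unfolding wdiff_def
  proof (intro exI allI)
    fix X
    show "((\<lambda>t. cnj (\<phi> (\<lambda>i. of_real t * X i))) has_vector_derivative
        (\<Sum>i\<in>I. cnj (b i) * X i + cnj (a i) * cnj (X i))) (at 0)"
      using bounded_linear.has_vector_derivative[OF bounded_linear_cnj ab[of X]]
      by (simp add: add.commute)
  qed
qed

text \<open>The outer function is complex differentiable, so by the chain rule both coefficient
  families are multiplied by the same number \<open>D\<close>.\<close>

lemma wdiff_compose:
  assumes "wdiff I \<phi>" and g: "(g has_field_derivative D) (at (\<phi> (\<lambda>_. 0)))"
  shows "wdiff I (\<lambda>X. g (\<phi> X))"
proof -
  obtain a b where ab: "\<And>X. ((\<lambda>t. \<phi> (\<lambda>i. of_real t * X i)) has_vector_derivative (\<Sum>i\<in>I. a i * X i + b i * cnj (X i))) (at 0)"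
    using assms(1) unfolding wdiff_def by blast
  show ?thesis unfolding wdiff_def
  proof (intro exI allI)
    fix X
    have "((g \<circ> (\<lambda>t. \<phi> (\<lambda>i. of_real t * X i))) has_vector_derivative
        (\<Sum>i\<in>I. a i * X i + b i * cnj (X i)) * D) (at 0)"
      by (rule field_vector_diff_chain_at[OF ab]) (use g in simp)
    moreover have "(\<Sum>i\<in>I. a i * X i + b i * cnj (X i)) * D = (\<Sum>i\<in>I. (D * a i) * X i + (D * b i) * cnj (X i))"
      unfolding sum_distrib_right by (intro sum.cong) (auto simp: algebra_simps)
    ultimately show "((\<lambda>t. g (\<phi> (\<lambda>i. of_real t * X i))) has_vector_derivative
        (\<Sum>i\<in>I. (D * a i) * X i + (D * b i) * cnj (X i))) (at 0)"
      by (simp add: o_def)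
  qed
qed

lemma wdiff_inverse:
  assumes "wdiff I \<phi>" "\<phi> (\<lambda>_. 0) \<noteq> 0"
  shows "wdiff I (\<lambda>X. inverse (\<phi> X))"
  by (rule wdiff_compose[OF assms(1) DERIV_inverse]) (rule assms(2))

lemma wdiff_ln_Re:
  assumes "wdiff I \<phi>" "Re (\<phi> (\<lambda>_. 0)) > 0"
  shows "wdiff I (\<lambda>X. of_real (ln (Re (\<phi> X))))"
proof -
  obtain a b where ab: "\<And>X. ((\<lambda>t. \<phi> (\<lambda>i. of_real t * X i)) has_vector_derivative (\<Sum>i\<in>I. a i * X i + b i * cnj (X i))) (at 0)"
    using assms(1) unfolding wdiff_def by blast
  \<comment> \<open>The factor \<open>1 / Re (\<phi> 0)\<close> comes from the derivative of
    \<open>ln\<close>, and the factor 1/2 from \<open>Re z = (z + cnj z) / 2\<close>, which rewrites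
    the real part in the form that \<open>wdiff\<close> demands.\<close>
  define r where "r = complex_of_real (1 / (2 * Re (\<phi> (\<lambda>_. 0))))"
  show ?thesis unfolding wdiff_def
  proof (intro exI allI)
    fix X
    let ?D = "\<Sum>i\<in>I. a i * X i + b i * cnj (X i)"
    have "((\<lambda>t. Re (\<phi> (\<lambda>i. of_real t * X i))) has_real_derivative Re ?D) (at 0)"
      using bounded_linear.has_vector_derivative[OF bounded_linear_Re ab[of X]]
      by (simp add: has_real_derivative_iff_has_vector_derivative)
    then have "((\<lambda>t. ln (Re (\<phi> (\<lambda>i. of_real t * X i)))) has_real_derivative 
        1 / Re (\<phi> (\<lambda>_. 0)) * Re ?D) (at 0)"
      using assms(2) by (intro DERIV_chain2[where f = ln and g = "\<lambda>t. Re (\<phi> (\<lambda>i. of_real t * X i))"]) 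
        (auto intro!: derivative_eq_intros)
    then have "((\<lambda>t. complex_of_real (ln (Re (\<phi> (\<lambda>i. of_real t * X i))))) has_vector_derivative 
        of_real (1 / Re (\<phi> (\<lambda>_. 0)) * Re ?D)) (at 0)"
      unfolding has_real_derivative_iff_has_vector_derivative
      by (rule bounded_linear.has_vector_derivative[OF bounded_linear_of_real])
    moreover have "of_real (1 / Re (\<phi> (\<lambda>_. 0)) * Re ?D) = r * (?D + cnj ?D)"
    proof -
      have "1 / x * y = 1 / (2 * x) * (2 * y)" for x y :: real by simp
      then show ?thesis unfolding r_def complex_add_cnj of_real_mult[symmetric] of_real_eq_iff .
    qed
    moreover have "r * (?D + cnj ?D) =
        (\<Sum>i\<in>I. (r * (a i + cnj (b i))) * X i + (r * (b i + cnj (a i))) * cnj (X i))"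
    proof -
      have "?D + cnj ?D = (\<Sum>i\<in>I. (a i + cnj (b i)) * X i + (b i + cnj (a i)) * cnj (X i))"
        unfolding cnj_sum sum.distrib[symmetric]
        by (rule sum.cong[OF refl]) (simp add: algebra_simps)
      then have "r * (?D + cnj ?D) = r * (\<Sum>i\<in>I. (a i + cnj (b i)) * X i + (b i + cnj (a i)) * cnj (X i))"
        by (rule arg_cong)
      also have "\<dots> = (\<Sum>i\<in>I. (r * (a i + cnj (b i))) * X i + (r * (b i + cnj (a i))) * cnj (X i))"
        unfolding sum_distrib_left by (rule sum.cong[OF refl]) (simp add: algebra_simps)
      finally show ?thesis .
    qed
    ultimately show "((\<lambda>t. complex_of_real (ln (Re (\<phi> (\<lambda>i. of_real t * X i))))) has_vector_derivative
        (\<Sum>i\<in>I. (r * (a i + cnj (b i))) * X i + (r * (b i + cnj (a i))) * cnj (X i))) (at 0)"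
      by (simp only:)
  qed
qed

text \<open>For real-valued \<open>f\<close> the derivative form is real, so it vanishes wherever
  the real directional derivative does. The directions \<open>e_p\<close> and
  \<open>\<i> * e_p\<close> give \<open>a p + b p = 0\<close> and
  \<open>\<i> * (a p - b p) = 0\<close>, so all coefficients are zero.\<close>

lemma wdiff_real_critical:
  fixes f :: "('i \<Rightarrow> complex) \<Rightarrow> real"
  assumes I: "finite I" and f: "wdiff I (\<lambda>X. of_real (f X))"
    and re: "\<And>p. p \<in> I \<Longrightarrow> deriv (\<lambda>t. f (\<lambda>i. if i = p then of_real t else 0)) 0 = 0"
    and im: "\<And>p. p \<in> I \<Longrightarrow> deriv (\<lambda>t. f (\<lambda>i. if i = p then \<i> * of_real t else 0)) 0 = 0"
  shows "((\<lambda>t. f (\<lambda>i. of_real t * X i)) has_real_derivative 0) (at 0)"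
proof -
  obtain a b where ab: "\<And>X. ((\<lambda>t. complex_of_real (f (\<lambda>i. of_real t * X i))) has_vector_derivative (\<Sum>i\<in>I. a i * X i + b i * cnj (X i))) (at 0)"
    using f unfolding wdiff_def by blast
  let ?D = "\<lambda>X. \<Sum>i\<in>I. a i * X i + b i * cnj (X i)"
  have D: "((\<lambda>t. f (\<lambda>i. of_real t * X i)) has_real_derivative Re (?D X)) (at 0)" for X
    using bounded_linear.has_vector_derivative[OF bounded_linear_Re ab[of X]]
    by (simp add: has_real_derivative_iff_has_vector_derivative)
  \<comment> \<open>The imaginary part of \<open>of_real (f ...)\<close> is constantly 0, hence so
    is its derivative.\<close>
  have real: "?D X \<in> \<real>" for X
    using vector_derivative_unique_at[OF bounded_linear.has_vector_derivative[OF bounded_linear_Im ab[of X]], of 0]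
    by (simp add: complex_is_Real_iff)
  have D0: "?D X = 0" if "deriv (\<lambda>t. f (\<lambda>i. of_real t * X i)) 0 = 0" for X
    using DERIV_imp_deriv[OF D[of X]] that real[of X] by (simp add: complex_is_Real_iff complex_eq_iff)
  have single: "?D (\<lambda>i. if i = p then z else 0) = a p * z + b p * cnj z" if "p \<in> I" for p z
  proof -
    have "?D (\<lambda>i. if i = p then z else 0) = (\<Sum>i\<in>I. if i = p then a p * z + b p * cnj z else 0)"
      by (intro sum.cong) auto
    then show ?thesis using that I by simp
  qed
  have "a p = 0 \<and> b p = 0" if p: "p \<in> I" for p
  proof -
    have "(\<lambda>t. f (\<lambda>i. of_real t * (if i = p then z else 0))) = (\<lambda>t. f (\<lambda>i. if i = p then z * of_real t else 0))" for z
      by (intro ext arg_cong[where f = f]) auto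
    then have "?D (\<lambda>i. if i = p then 1 else 0) = 0" "?D (\<lambda>i. if i = p then \<i> else 0) = 0"
      using D0[of "\<lambda>i. if i = p then 1 else 0"] D0[of "\<lambda>i. if i = p then \<i> else 0"] re[OF p] im[OF p]
      by (simp_all only: mult_1)
    then have "a p + b p = 0" "(a p - b p) * \<i> = 0"
      unfolding single[OF p] by (auto simp: algebra_simps)
    then show ?thesis by (auto simp: complex_eq_iff)
  qed
  then have "?D X = 0" by simp
  with D[of X] show ?thesis by simp
qed

section \<open>Differentiability of matrix-valued functions\<close>

definition wdiff_mat :: "'i set \<Rightarrow> nat \<Rightarrow> nat \<Rightarrow> (('i \<Rightarrow> complex) \<Rightarrow> complex mat) \<Rightarrow> bool" where
  "wdiff_mat I nr nc M \<longleftrightarrow>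
     (\<forall>X. M X \<in> carrier_mat nr nc) \<and> (\<forall>i<nr. \<forall>j<nc. wdiff I (\<lambda>X. M X $$ (i, j)))"

lemma wdiff_mat_const: "A \<in> carrier_mat nr nc \<Longrightarrow> wdiff_mat I nr nc (\<lambda>X. A)"
  unfolding wdiff_mat_def by (auto simp: wdiff_const)

lemma wdiff_mat_add:
  assumes "wdiff_mat I nr nc M" "wdiff_mat I nr nc N"
  shows "wdiff_mat I nr nc (\<lambda>X. M X + N X)"
proof -
  have "dim_row (N X) = nr" "dim_col (N X) = nc" for X
    using assms unfolding wdiff_mat_def by auto
  then show ?thesis using assms unfolding wdiff_mat_def by (auto simp: wdiff_add)
qed

lemma wdiff_mat_mult:
  assumes "wdiff_mat I nr n M" "wdiff_mat I n nc N"
  shows "wdiff_mat I nr nc (\<lambda>X. M X * N X)"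
  unfolding wdiff_mat_def
proof safe
  have c: "M X \<in> carrier_mat nr n" "N X \<in> carrier_mat n nc" for X
    using assms unfolding wdiff_mat_def by auto
  then show "M X * N X \<in> carrier_mat nr nc" for X by (rule mult_carrier_mat)
  fix i j assume ij: "i < nr" "j < nc"
  have "dim_row (M X) = nr" "dim_col (M X) = n" "dim_row (N X) = n" "dim_col (N X) = nc" for X
    using c[of X] by auto
  then have "(M X * N X) $$ (i, j) = (\<Sum>l<n. M X $$ (i, l) * N X $$ (l, j))" for X
    using ij by (simp add: scalar_prod_def atLeast0LessThan)
  moreover have "wdiff I (\<lambda>X. \<Sum>l<n. M X $$ (i, l) * N X $$ (l, j))"
    using assms ij unfolding wdiff_mat_def by (intro wdiff_sum wdiff_mult) auto
  ultimately show "wdiff I (\<lambda>X. (M X * N X) $$ (i, j))" by simp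
qed

text \<open>The Leibniz formula makes the determinant a polynomial in the entries.\<close>

lemma wdiff_mat_det:
  assumes "wdiff_mat I n n M"
  shows "wdiff I (\<lambda>X. det (M X))"
proof -
  have "M X \<in> carrier_mat n n" for X using assms unfolding wdiff_mat_def by auto
  note det = det_def'[OF this]
  have "wdiff I (\<lambda>X. M X $$ (i, p i))" if "p permutes {0..<n}" "i \<in> {0..<n}" for p i
    using assms permutes_in_image[OF that(1), of i] that(2) unfolding wdiff_mat_def by auto
  then show ?thesis unfolding det by (intro wdiff_sum wdiff_mult wdiff_prod wdiff_const) auto
qed

text \<open>Cramer's rule. \<open>mat_inverse\<close> is computed by Gauss-Jordan elimination, whose
  case distinctions are awkward to differentiate; this formula makes the entries rational functions
  of the entries of \<open>A\<close>.\<close>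

lemma mat_inverse_eq_adj_mat:
  fixes A :: "'a :: field mat"
  assumes A: "A \<in> carrier_mat n n" and d: "det A \<noteq> 0"
  shows "the (mat_inverse A) = inverse (det A) \<cdot>\<^sub>m adj_mat A"
proof -
  let ?B = "inverse (det A) \<cdot>\<^sub>m adj_mat A"
  have B: "?B \<in> carrier_mat n n" "A * ?B = 1\<^sub>m n" "?B * A = 1\<^sub>m n"
    using adj_mat[OF A] A d by (auto simp: mult_smult_distrib mult_smult_assoc_mat intro!: eq_matI)
  then have "A \<in> Units (ring_mat TYPE('a) n ())"
    unfolding Units_def using A by (auto simp: ring_mat_def)
  then obtain C where C: "mat_inverse A = Some C"
    using mat_inverse(1)[OF A, where b = "()"] by (cases "mat_inverse A") auto
  from mat_inverse(2)[OF A C] have "A * C = 1\<^sub>m n" "C \<in> carrier_mat n n" by auto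
  then have "C = ?B" using assoc_mult_mat[OF B(1) A, of C n] right_mult_one_mat[OF B(1)] B(3)
    by simp
  then show ?thesis using C by simp
qed

text \<open>Each entry is a cofactor divided by the determinant. The determinant is nonzero for
  every \<open>X\<close>, so this formula can replace the inverse along whole lines through the
  origin.\<close>

lemma wdiff_mat_inverse:
  assumes M: "wdiff_mat I n n M" and d: "\<And>X. det (M X) \<noteq> 0"
  shows "wdiff_mat I n n (\<lambda>X. the (mat_inverse (M X)))"
  unfolding wdiff_mat_def
proof safe
  have c: "M X \<in> carrier_mat n n" for X
    using M unfolding wdiff_mat_def by auto
  note eq = mat_inverse_eq_adj_mat[OF c d]
  show "the (mat_inverse (M X)) \<in> carrier_mat n n" for X
    using adj_mat(1)[OF c[of X]] eq by auto
  fix i j assume ij: "i < n" "j < n"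
  have dim: "dim_row (M X) = n" "dim_col (M X) = n" for X using c[of X] by auto
  \<comment> \<open>Row \<open>j\<close> and column \<open>i\<close> are deleted because the
    adjugate is the transposed cofactor matrix.\<close>
  have "wdiff_mat I (n - 1) (n - 1) (\<lambda>X. mat_delete (M X) j i)"
    using M ij unfolding wdiff_mat_def mat_delete_def dim by auto
  then have "wdiff I (\<lambda>X. inverse (det (M X)) * cofactor (M X) j i)"
    unfolding cofactor_def
    by (intro wdiff_mult wdiff_const wdiff_inverse wdiff_mat_det[OF M] d) (rule wdiff_mat_det)
  then show "wdiff I (\<lambda>X. the (mat_inverse (M X)) $$ (i, j))"
    unfolding eq using ij dim by (simp add: adj_mat_def)
qed

lemma mat_adjoint_dim [simp]:
  "dim_row (mat_adjoint A) = dim_col A" "dim_col (mat_adjoint A) = dim_row A"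
  unfolding mat_adjoint_def by auto

lemma mat_adjoint_index [simp]:
  fixes A :: "complex mat"
  shows "i < dim_col A \<Longrightarrow> j < dim_row A \<Longrightarrow> mat_adjoint A $$ (i, j) = cnj (A $$ (j, i))"
  unfolding mat_adjoint_def by (simp add: mat_of_rows_def)

lemma wdiff_mat_adjoint:
  assumes "wdiff_mat I nr nc M"
  shows "wdiff_mat I nc nr (\<lambda>X. mat_adjoint (M X))"
proof -
  have c: "M X \<in> carrier_mat nr nc" for X
    using assms unfolding wdiff_mat_def by auto
  have dim: "dim_row (M X) = nr" "dim_col (M X) = nc" for X using c[of X] by auto
  show ?thesis
    using assms mat_adjoint_carrier[OF c] unfolding wdiff_mat_def by (auto simp: dim wdiff_cnj)
qed

lemma wdiff_mat_sum:
  assumes "\<And>a. a \<in> A \<Longrightarrow> wdiff_mat I nr nc (M a)"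
  shows "wdiff_mat I nr nc (\<lambda>X. mat_sum nr nc (\<lambda>a. M a X) A)"
  using assms unfolding wdiff_mat_def mat_sum_def by (auto intro!: wdiff_sum)

subsection \<open>Positive semidefinite matrices\<close>

lemma mat_adjoint_mult:
  fixes A B :: "complex mat"
  assumes A: "A \<in> carrier_mat n m" and B: "B \<in> carrier_mat m l"
  shows "mat_adjoint (A * B) = mat_adjoint B * mat_adjoint A"
  using A B by (intro eq_matI) (auto simp: scalar_prod_def mult.commute intro!: sum.cong)

lemma mat_adjoint_adjoint [simp]: "mat_adjoint (mat_adjoint A) = A"
  for A :: "complex mat"
  by (intro eq_matI) auto

lemma mult_mat_vec_cscalar:
  fixes A :: "complex mat"
  assumes A: "A \<in> carrier_mat n m" and x: "x \<in> carrier_vec m" and y: "y \<in> carrier_vec n"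
  shows "(A *\<^sub>v x) \<bullet>c y = x \<bullet>c (mat_adjoint A *\<^sub>v y)"
proof -
  have "(A *\<^sub>v x) \<bullet>c y = (\<Sum>i<n. \<Sum>j<m. A $$ (i, j) * x $ j * cnj (y $ i))"
    using A x y by (auto simp: scalar_prod_def atLeast0LessThan sum_distrib_right intro!: sum.cong)
  also have "\<dots> = (\<Sum>j<m. \<Sum>i<n. A $$ (i, j) * x $ j * cnj (y $ i))"
    by (rule sum.swap)
  also have "\<dots> = x \<bullet>c (mat_adjoint A *\<^sub>v y)"
    using A x y by (auto simp: scalar_prod_def atLeast0LessThan sum_distrib_left intro!: sum.cong)
  finally show ?thesis .
qed

text \<open>In the order on complex numbers, \<open>0 \<le> z\<close> says that \<open>z\<close> is
  real and nonnegative. A real quadratic form on a complex space forces the matrix to be Hermitian,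
  so this is not a separate condition.\<close>

definition psd_mat :: "nat \<Rightarrow> complex mat \<Rightarrow> bool" where
  "psd_mat n A \<longleftrightarrow> A \<in> carrier_mat n n \<and> (\<forall>v\<in>carrier_vec n. 0 \<le> (A *\<^sub>v v) \<bullet>c v)"

lemma psd_mat_0: "psd_mat n (0\<^sub>m n n)"
proof -
  have "0\<^sub>m n n *\<^sub>v v = 0\<^sub>v n" if "v \<in> carrier_vec n" for v :: "complex vec"
    using that by (intro eq_vecI) auto
  then show ?thesis unfolding psd_mat_def by simp
qed

lemma psd_mat_add:
  assumes "psd_mat n A" "psd_mat n B"
  shows "psd_mat n (A + B)"
  unfolding psd_mat_def
proof safe
  have A: "A \<in> carrier_mat n n" and B: "B \<in> carrier_mat n n"
    using assms unfolding psd_mat_def by auto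
  then show "A + B \<in> carrier_mat n n" by simp
  fix v :: "complex vec" assume v: "v \<in> carrier_vec n"
  have "((A + B) *\<^sub>v v) \<bullet>c v = (A *\<^sub>v v) \<bullet>c v + (B *\<^sub>v v) \<bullet>c v"
    using A B v by (simp add: add_mult_distrib_mat_vec[OF A B v] add_scalar_prod_distrib[of _ n])
  then show "0 \<le> ((A + B) *\<^sub>v v) \<bullet>c v" using assms v unfolding psd_mat_def by auto
qed

lemma psd_mat_mat_sum:
  assumes "\<And>i. i \<in> I \<Longrightarrow> psd_mat n (A i)"
  shows "psd_mat n (mat_sum n n A I)"
  using assms
proof (induction I rule: infinite_finite_induct)
  case (insert i I)
  have "A i \<in> carrier_mat n n" using insert unfolding psd_mat_def by auto
  then have "mat_sum n n A (insert i I) = A i + mat_sum n n A I"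
    using insert by (intro eq_matI) (auto simp: mat_sum_def)
  then show ?case using insert psd_mat_add by auto
next
  case (infinite I)
  then have "mat_sum n n A I = 0\<^sub>m n n" by (intro eq_matI) (auto simp: mat_sum_def)
  then show ?case by (simp add: psd_mat_0)
next
  case empty
  have "mat_sum n n A {} = 0\<^sub>m n n" by (intro eq_matI) (auto simp: mat_sum_def)
  then show ?case by (simp add: psd_mat_0)
qed

text \<open>The quadratic form at \<open>v\<close> is the squared norm of
  \<open>mat_adjoint A *\<^sub>v v\<close>.\<close>

lemma psd_mat_mult_adjoint:
  assumes A: "A \<in> carrier_mat n m"
  shows "psd_mat n (A * mat_adjoint A)"
  unfolding psd_mat_def
proof safe
  note A' = mat_adjoint_carrier[OF A]
  show "A * mat_adjoint A \<in> carrier_mat n n" using A A' by simp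
  fix v :: "complex vec" assume v: "v \<in> carrier_vec n"
  have "((A * mat_adjoint A) *\<^sub>v v) \<bullet>c v = (A *\<^sub>v (mat_adjoint A *\<^sub>v v)) \<bullet>c v"
    using assoc_mult_mat_vec[OF A A' v] by simp
  also have "\<dots> = (mat_adjoint A *\<^sub>v v) \<bullet>c (mat_adjoint A *\<^sub>v v)"
    using mult_mat_vec_cscalar[OF A _ v] A' v by simp
  finally show "0 \<le> ((A * mat_adjoint A) *\<^sub>v v) \<bullet>c v" by auto
qed

text \<open>The quadratic form at \<open>v\<close> gains the summand
  \<open>s * (v \<bullet>c v)\<close>, which is positive for \<open>v \<noteq> 0\<close>. So the
  shifted matrix has trivial kernel.\<close>

lemma psd_mat_shift:
  assumes A: "psd_mat n A" and s: "s > 0"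
  shows "psd_mat n (complex_of_real s \<cdot>\<^sub>m 1\<^sub>m n + A)"
    and "det (complex_of_real s \<cdot>\<^sub>m 1\<^sub>m n + A) \<noteq> 0"
proof -
  let ?F = "complex_of_real s \<cdot>\<^sub>m 1\<^sub>m n + A"
  have Ac: "A \<in> carrier_mat n n" using A unfolding psd_mat_def by auto
  have form: "(?F *\<^sub>v v) \<bullet>c v = complex_of_real s * (v \<bullet>c v) + (A *\<^sub>v v) \<bullet>c v" if v: "v \<in> carrier_vec n" for v
  proof -
    have "(complex_of_real s \<cdot>\<^sub>m 1\<^sub>m n) *\<^sub>v v = complex_of_real s \<cdot>\<^sub>v (1\<^sub>m n *\<^sub>v v)"
    proof (intro eq_vecI)
      fix i assume "i < dim_vec (complex_of_real s \<cdot>\<^sub>v (1\<^sub>m n *\<^sub>v v))"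
      then have i: "i < n" by simp
      then have "row (complex_of_real s \<cdot>\<^sub>m 1\<^sub>m n) i = complex_of_real s \<cdot>\<^sub>v unit_vec n i"
        by (intro eq_vecI) auto
      then show "((complex_of_real s \<cdot>\<^sub>m 1\<^sub>m n) *\<^sub>v v) $ i = (complex_of_real s \<cdot>\<^sub>v (1\<^sub>m n *\<^sub>v v)) $ i"
        using i v by simp
    qed simp
    then have "?F *\<^sub>v v = complex_of_real s \<cdot>\<^sub>v v + A *\<^sub>v v"
      using Ac v by (simp add: add_mult_distrib_mat_vec[OF _ Ac v])
    then show ?thesis using Ac v by (simp add: add_scalar_prod_distrib[of _ n])
  qed
  have sp: "0 \<le> complex_of_real s * z" if "0 \<le> z" for z
    using that s by (simp add: less_eq_complex_def)
  show "psd_mat n ?F"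
    unfolding psd_mat_def
  proof safe
    fix v :: "complex vec" assume v: "v \<in> carrier_vec n"
    have "0 \<le> (A *\<^sub>v v) \<bullet>c v" using A v unfolding psd_mat_def by auto
    then show "0 \<le> (?F *\<^sub>v v) \<bullet>c v" unfolding form[OF v] using sp by (intro add_nonneg_nonneg) auto
  qed (use Ac in auto)
  show "det ?F \<noteq> 0"
  proof
    assume "det ?F = 0"
    then obtain v where v: "v \<in> carrier_vec n" "v \<noteq> 0\<^sub>v n" "?F *\<^sub>v v = 0\<^sub>v n"
      using det_0_iff_vec_prod_zero_field[of ?F n] Ac by auto
    have "0 < v \<bullet>c v" using conjugate_square_greater_0_vec[OF v(1)] v(2) by simp
    then have "0 < complex_of_real s * (v \<bullet>c v)" using s by (simp add: less_complex_def)
    moreover have "0 \<le> (A *\<^sub>v v) \<bullet>c v" using A v(1) unfolding psd_mat_def by auto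
    ultimately have "0 < (?F *\<^sub>v v) \<bullet>c v" unfolding form[OF v(1)] by (rule add_pos_nonneg)
    then show False using v by simp
  qed
qed

text \<open>For \<open>x = X *\<^sub>v (G *\<^sub>v v)\<close> one has
  \<open>F *\<^sub>v x = G *\<^sub>v v\<close>, so the form at \<open>v\<close> is the conjugate of
  the form of \<open>F\<close> at \<open>x\<close>, which is real and nonnegative.\<close>

lemma psd_mat_congruence_inverse:
  assumes F: "psd_mat n F" and X: "X \<in> carrier_mat n n" "F * X = 1\<^sub>m n" and G: "G \<in> carrier_mat n m"
  shows "psd_mat m (mat_adjoint G * X * G)"
  unfolding psd_mat_def
proof safe
  note G' = mat_adjoint_carrier[OF G]
  have Fc: "F \<in> carrier_mat n n" using F unfolding psd_mat_def by auto
  show "mat_adjoint G * X * G \<in> carrier_mat m m" using G G' X by simp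
  fix v :: "complex vec" assume v: "v \<in> carrier_vec m"
  define x where "x = X *\<^sub>v (G *\<^sub>v v)"
  have x: "x \<in> carrier_vec n" unfolding x_def using X G v by simp
  have Gv: "G *\<^sub>v v \<in> carrier_vec n" using G v by simp
  have Fx: "F *\<^sub>v x = G *\<^sub>v v"
    unfolding x_def using assoc_mult_mat_vec[OF Fc X(1) Gv] X(2) Gv by simp
  have "(mat_adjoint G * X * G) *\<^sub>v v = mat_adjoint G *\<^sub>v x"
    unfolding x_def using G G' X v Gv
    by (metis assoc_mult_mat_vec mult_carrier_mat)
  then have "((mat_adjoint G * X * G) *\<^sub>v v) \<bullet>c v = x \<bullet>c (G *\<^sub>v v)"
    using mult_mat_vec_cscalar[OF G' x v] by simp
  also have "\<dots> = conjugate ((F *\<^sub>v x) \<bullet>c x)"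
    unfolding Fx using conjugate_conjugate_sprod[OF Gv x] conjugate_vec_sprod_comm[OF x Gv] 
    by (metis conjugate_id conjugate_vec_sprod_comm Gv x conjugate_conjugate_sprod)
  finally have "((mat_adjoint G * X * G) *\<^sub>v v) \<bullet>c v = cnj ((F *\<^sub>v x) \<bullet>c x)" by simp
  moreover have "0 \<le> (F *\<^sub>v x) \<bullet>c x" using F x unfolding psd_mat_def by auto
  ultimately show "0 \<le> ((mat_adjoint G * X * G) *\<^sub>v v) \<bullet>c v"
    by (simp add: less_eq_complex_def)
qed

lemma psd_mat_eigenvalue_nonneg:
  assumes A: "psd_mat n A" and e: "eigenvalue A e"
  shows "0 \<le> e"
proof -
  have Ac: "A \<in> carrier_mat n n" using A unfolding psd_mat_def by auto
  obtain v where v: "v \<in> carrier_vec n" "v \<noteq> 0\<^sub>v n" "A *\<^sub>v v = e \<cdot>\<^sub>v v"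
    using e Ac unfolding eigenvalue_def eigenvector_def by auto
  have p: "0 < v \<bullet>c v" using conjugate_square_greater_0_vec[OF v(1)] v(2) by simp
  have "0 \<le> (A *\<^sub>v v) \<bullet>c v" using A v(1) unfolding psd_mat_def by auto
  then have "0 \<le> e * (v \<bullet>c v)" unfolding v(3) using v(1) by simp
  with p show ?thesis
    by (auto simp: less_eq_complex_def less_complex_def zero_le_mult_iff)
qed

section \<open>Determinants of \<open>1 + s A\<close> in terms of eigenvalues\<close>

lemma det_one_plus_smult_eq_prod_eigenvalues:
  fixes A :: "complex mat"
  assumes A: "A \<in> carrier_mat n n" and es: "char_poly A = (\<Prod>e\<leftarrow>es. [:- e, 1:])" and len: "length es = n"
  shows "det (1\<^sub>m n + s \<cdot>\<^sub>m A) = (\<Prod>e\<leftarrow>es. 1 + s * e)"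
proof (cases "s = 0")
  case True
  have "1\<^sub>m n + 0 \<cdot>\<^sub>m A = 1\<^sub>m n" using A by (intro eq_matI) auto
  moreover have "(\<Prod>e\<leftarrow>es. 1::complex) = 1" by (induction es) auto
  ultimately show ?thesis using True by simp
next
  case False
  \<comment> \<open>For \<open>s \<noteq> 0\<close>, \<open>1 + s A = (-s) ((-1/s) 1 - A)\<close>,
    so the determinant is \<open>(-s)^n\<close> times the characteristic polynomial at
    \<open>-1/s\<close>.\<close>
  have "1\<^sub>m n + s \<cdot>\<^sub>m A = (-s) \<cdot>\<^sub>m (- char_matrix A (- 1 / s))"
    using A False by (intro eq_matI) (auto simp: char_matrix_def field_simps)
  then have "det (1\<^sub>m n + s \<cdot>\<^sub>m A) = (-s) ^ n * poly (char_poly A) (- 1 / s)"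
    using carrier_matD(2)[OF char_matrix_closed[OF A]] by (simp add: char_poly_matrix[OF A])
  also have "\<dots> = (-s) ^ length es * (\<Prod>e\<leftarrow>es. - e - 1 / s)"
    unfolding es len by (simp add: poly_prod_list o_def)
  also have "\<dots> = (\<Prod>e\<leftarrow>es. 1 + s * e)"
    using False by (induction es) (auto simp: field_simps)
  finally show ?thesis .
qed

text \<open>The list \<open>ls\<close> holds the eigenvalues with multiplicity; the characteristic
  polynomial splits over the complex numbers and its roots are real and nonnegative here. One list
  serves all \<open>s\<close>.\<close>

lemma psd_mat_det_one_plus_smult:
  assumes A: "psd_mat n A"
  obtains ls :: "real list" where "\<And>l. l \<in> set ls \<Longrightarrow> 0 \<le> l"
    and "\<And>s. det (1\<^sub>m n + complex_of_real s \<cdot>\<^sub>m A) = complex_of_real (\<Prod>l\<leftarrow>ls. 1 + s * l)"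
proof -
  have Ac: "A \<in> carrier_mat n n" using A unfolding psd_mat_def by auto
  obtain es where es: "char_poly A = (\<Prod>e\<leftarrow>es. [:- e, 1:])" "length es = n"
    using char_poly_factorized[OF Ac] by blast
  have "poly (char_poly A) e = 0" if "e \<in> set es" for e
    unfolding es(1) using that by (auto simp: poly_prod_list prod_list_zero_iff)
  then have nn: "0 \<le> e" if "e \<in> set es" for e
    using that eigenvalue_root_char_poly[OF Ac] psd_mat_eigenvalue_nonneg[OF A] by blast
  show ?thesis
  proof
    show "0 \<le> l" if "l \<in> set (map Re es)" for l
      using that nn by (auto simp: less_eq_complex_def)
    fix s :: real
    have "(\<Prod>e\<leftarrow>es. 1 + complex_of_real s * e) = complex_of_real (\<Prod>l\<leftarrow>map Re es. 1 + s * l)"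
      using nn by (induction es) (auto simp: less_eq_complex_def complex_eq_iff)
    then show "det (1\<^sub>m n + complex_of_real s \<cdot>\<^sub>m A) = complex_of_real (\<Prod>l\<leftarrow>map Re es. 1 + s * l)"
      using det_one_plus_smult_eq_prod_eigenvalues[OF Ac es] by simp
  qed
qed

lemma psd_mat_det_one_plus_pos:
  assumes A: "psd_mat n A"
  shows "0 < Re (det (1\<^sub>m n + A))"
proof -
  obtain ls where ls: "\<And>l. l \<in> set ls \<Longrightarrow> 0 \<le> l"
    "\<And>s. det (1\<^sub>m n + complex_of_real s \<cdot>\<^sub>m A) = complex_of_real (\<Prod>l\<leftarrow>ls. 1 + s * l)"
    using psd_mat_det_one_plus_smult[OF A] by blast
  have "0 < (\<Prod>l\<leftarrow>ls. 1 + 1 * l)" using ls(1) by (induction ls) (auto simp: add_pos_nonneg)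
  moreover have "1 \<cdot>\<^sub>m A = A" by (intro eq_matI) auto
  ultimately show ?thesis using ls(2)[of 1] by simp
qed

text \<open>The logarithm is the sum of \<open>ln (1 + (1 + t)\<^sup>2 * l)\<close> over the
  eigenvalues \<open>l\<close>, with derivative the sum of \<open>2 * l / (1 + l)\<close> at 0. No
  summand is negative, and if all were zero then the determinant would be 1 and its logarithm
  0.\<close>

lemma psd_mat_ln_det_derivative:
  assumes A: "psd_mat n A" and ne: "ln (Re (det (1\<^sub>m n + A))) \<noteq> 0"
  obtains D where "D > 0"
    and "((\<lambda>t. ln (Re (det (1\<^sub>m n + complex_of_real ((1 + t)\<^sup>2) \<cdot>\<^sub>m A)))) has_real_derivative D) (at 0)"
proof -
  obtain ls where ls: "\<And>l. l \<in> set ls \<Longrightarrow> 0 \<le> l"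
    "\<And>s. det (1\<^sub>m n + complex_of_real s \<cdot>\<^sub>m A) = complex_of_real (\<Prod>l\<leftarrow>ls. 1 + s * l)"
    using psd_mat_det_one_plus_smult[OF A] by blast
  define D where "D = (\<Sum>l\<leftarrow>ls. 2 * l / (1 + l))"
  have ln_prod: "ln (\<Prod>l\<leftarrow>ls. 1 + (1 + t)\<^sup>2 * l) = (\<Sum>l\<leftarrow>ls. ln (1 + (1 + t)\<^sup>2 * l))"
    and pos: "0 < (\<Prod>l\<leftarrow>ls. 1 + (1 + t)\<^sup>2 * l)" for t
  proof -
    have "0 < (\<Prod>l\<leftarrow>ls. 1 + (1 + t)\<^sup>2 * l) \<and> ln (\<Prod>l\<leftarrow>ls. 1 + (1 + t)\<^sup>2 * l) = (\<Sum>l\<leftarrow>ls. ln (1 + (1 + t)\<^sup>2 * l))"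
      using ls(1)
    proof (induction ls)
      case (Cons l ls)
      have "0 < 1 + (1 + t)\<^sup>2 * l" using Cons.prems[of l] by (simp add: add_pos_nonneg)
      with Cons show ?case by (simp add: ln_mult_pos)
    qed auto
    then show "ln (\<Prod>l\<leftarrow>ls. 1 + (1 + t)\<^sup>2 * l) = (\<Sum>l\<leftarrow>ls. ln (1 + (1 + t)\<^sup>2 * l))"
      "0 < (\<Prod>l\<leftarrow>ls. 1 + (1 + t)\<^sup>2 * l)" by auto
  qed
  have "((\<lambda>t. \<Sum>l\<leftarrow>ls. ln (1 + (1 + t)\<^sup>2 * l)) has_real_derivative D) (at 0)"
    unfolding D_def using ls(1)
  proof (induction ls)
    case (Cons l ls)
    have "((\<lambda>t. ln (1 + (1 + t)\<^sup>2 * l)) has_real_derivative 2 * l / (1 + l)) (at 0)"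
      using Cons.prems[of l] by (auto intro!: derivative_eq_intros simp: field_simps)
    with Cons show ?case by (auto intro!: DERIV_add)
  qed auto
  moreover have "D > 0"
  proof -
    have one: "1 \<cdot>\<^sub>m A = A" by (intro eq_matI) auto
    have "\<exists>l\<in>set ls. l \<noteq> 0"
    proof (rule ccontr)
      assume "\<not> ?thesis"
      then have "(\<Prod>l\<leftarrow>ls. 1 + 1 * l) = 1" by (induction ls) auto
      then show False using ne ls(2)[of 1] one by simp
    qed
    then obtain l where l: "l \<in> set ls" "l \<noteq> 0" by blast
    have nn: "0 \<le> 2 * l / (1 + l)" if "l \<in> set ls" for l using ls(1)[OF that] by simp
    have "0 < l" using ls(1)[OF l(1)] l(2) by simp
    then have "0 < 2 * l / (1 + l)" by simp
    also have "\<dots> \<le> D" unfolding D_def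
      by (rule member_le_sum_list) (use l nn in auto)
    finally show ?thesis .
  qed
  ultimately show ?thesis using that by (simp only: ls(2) Re_complex_of_real ln_prod)
qed

subsection \<open>Block matrices and full row rank\<close>

text \<open>A maximal independent set of columns has \<open>n\<close> elements, hence is a basis of
  the whole space. So every unit vector is some \<open>A *\<^sub>v x i\<close>, and the vectors
  \<open>x i\<close> are the columns of the right inverse.\<close>

lemma full_row_rank_right_inverse:
  fixes A :: "complex mat"
  assumes A: "A \<in> carrier_mat n m" and r: "vec_space.rank n A = n"
  obtains B where "B \<in> carrier_mat m n" "A * B = 1\<^sub>m n"
proof -
  interpret vec_space "TYPE(complex)" n .
  have cols: "set (cols A) \<subseteq> carrier_vec n" using A cols_dim by blast
  define P where "P = (\<lambda>T. T \<subseteq> set (cols A) \<and> lin_indpt T)"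
  have "\<exists>S. maximal S P"
  proof -
    have "\<And>T. P T \<Longrightarrow> finite T \<and> card T \<le> card (set (cols A))"
      unfolding P_def by (meson List.finite_set card_mono finite_subset)
    moreover have "P {}" unfolding P_def using lin_dep_def by auto
    ultimately show ?thesis using maximal_exists[of P "card (set (cols A))" "{}"] by blast
  qed
  then obtain S where S: "maximal S P" by blast
  then have Ss: "S \<subseteq> set (cols A)" "lin_indpt S" unfolding maximal_def P_def by auto
  have "card S = n" using rank_card_indpt[OF A] S r unfolding P_def by auto
  moreover have "finite S" using Ss finite_subset by blast
  ultimately have "basis S"
    using Ss cols by (intro dim_li_is_basis) (auto simp: dim_is_n)
  then have "span S = carrier_vec n" unfolding basis_def by auto
  then have full: "carrier_vec n \<subseteq> col_space A"
    unfolding col_space_def using span_is_monotone[OF Ss(1)] by auto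
  have "\<exists>x. x \<in> carrier_vec m \<and> A *\<^sub>v x = unit_vec n i" for i
    using full col_space_eq[OF A] A by (auto dest!: subsetD[OF _ unit_vec_carrier[of n i]])
  then obtain x where x: "\<And>i. x i \<in> carrier_vec m" "\<And>i. A *\<^sub>v x i = unit_vec n i" by metis
  show ?thesis
  proof
    let ?B = "mat_of_cols m (map x [0..<n])"
    show B: "?B \<in> carrier_mat m n" by auto
    show "A * ?B = 1\<^sub>m n"
    proof (intro mat_col_eqI)
      fix i assume "i < dim_col (1\<^sub>m n :: complex mat)"
      then have i: "i < n" by simp
      have "col (A * ?B) i = A *\<^sub>v col ?B i" using col_mult2[OF A B i] by simp
      also have "col ?B i = x i" using i x by simp
      finally show "col (A * ?B) i = col (1\<^sub>m n) i" using x i by simp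
    qed (use A in auto)
  qed
qed

lemma append_cols_mult_append_rows:
  fixes A :: "'a :: comm_ring_1 mat"
  assumes "A \<in> carrier_mat n a" "A' \<in> carrier_mat n a'" "B \<in> carrier_mat a m" "B' \<in> carrier_mat a' m"
  shows "append_cols A A' * (B @\<^sub>r B') = A * B + A' * B'"
proof -
  \<comment> \<open>Both factors are four-block matrices with empty lower or right blocks, so the
    general block product applies and only its upper left block is nonempty.\<close>
  have "append_cols A A' * (B @\<^sub>r B') = four_block_mat (A * B + A' * B')
     (A * 0\<^sub>m a 0 + A' * 0\<^sub>m a' 0) (0\<^sub>m 0 a * B + 0\<^sub>m 0 a' * B') (0\<^sub>m 0 a * 0\<^sub>m a 0 + 0\<^sub>m 0 a' * 0\<^sub>m a' 0)"
    unfolding append_cols_def append_rows_def using assms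
    by (subst mult_four_block_mat[of _ n a _ a' _ 0 _ _ m _ 0]) auto
  also have "\<dots> = A * B + A' * B'" using assms by (intro eq_matI) auto
  finally show ?thesis .
qed

text \<open>The right-hand side sums over a set; \<open>distinct\<close> ensures that each block
  product is counted as often as it occurs in the list.\<close>

lemma hcat_mult_vcat:
  fixes A :: "nat \<Rightarrow> 'a :: comm_ring_1 mat"
  assumes "\<And>c. c \<in> set cs \<Longrightarrow> A c \<in> carrier_mat n l" "\<And>c. c \<in> set cs \<Longrightarrow> B c \<in> carrier_mat l m"
    and "distinct cs"
  shows "hcat n (map A cs) * vcat m (map B cs) = mat_sum n m (\<lambda>c. A c * B c) (set cs)"
  using assms
proof (induction cs)
  case Nil
  then show ?case by (intro eq_matI) (auto simp: hcat_def vcat_def mat_sum_def scalar_prod_def)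
next
  case (Cons c cs)
  have A: "hcat n (map A cs) \<in> carrier_mat n (l * length (map A cs))"
    by (rule hcat_carrier) (use Cons in auto)
  have B: "vcat m (map B cs) \<in> carrier_mat (l * length (map B cs)) m"
    by (rule vcat_carrier) (use Cons in auto)
  have "hcat n (map A (c # cs)) * vcat m (map B (c # cs))
      = A c * B c + hcat n (map A cs) * vcat m (map B cs)"
    using append_cols_mult_append_rows[of "A c" n l _ _ "B c" m] A B Cons.prems
    by (simp add: hcat_def vcat_def)
  also have "\<dots> = A c * B c + mat_sum n m (\<lambda>c. A c * B c) (set cs)"
    using Cons by simp
  also have "\<dots> = mat_sum n m (\<lambda>c. A c * B c) (set (c # cs))"
    using Cons.prems by (intro eq_matI) (auto simp: mat_sum_def)
  finally show ?case .
qed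

lemma append_cols_eq_0:
  assumes A: "A \<in> carrier_mat n a" and B: "B \<in> carrier_mat n b"
    and eq: "append_cols A B = 0\<^sub>m n l"
  shows "A = 0\<^sub>m n a" "B = 0\<^sub>m n b"
proof -
  have "append_cols A B \<in> carrier_mat n (a + b)" using A B by (rule append_cols_carrier)
  then have l: "l = a + b" unfolding eq by auto
  show "A = 0\<^sub>m n a"
  proof (intro eq_matI)
    fix i j assume ij: "i < dim_row (0\<^sub>m n a)" "j < dim_col (0\<^sub>m n a)"
    have "append_cols A B $$ (i, j) = A $$ (i, j)"
      using ij A B unfolding append_cols_def by (subst index_mat_four_block) auto
    then show "A $$ (i, j) = 0\<^sub>m n a $$ (i, j)" using ij l unfolding eq by simp
  qed (use A in auto)
  show "B = 0\<^sub>m n b"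
  proof (intro eq_matI)
    fix i j assume ij: "i < dim_row (0\<^sub>m n b)" "j < dim_col (0\<^sub>m n b)"
    have "append_cols A B $$ (i, a + j) = B $$ (i, j)"
      using ij A B unfolding append_cols_def by (subst index_mat_four_block) auto
    then show "B $$ (i, j) = 0\<^sub>m n b $$ (i, j)" using ij l unfolding eq by simp
  qed (use B in auto)
qed

lemma hcat_carrier_sum:
  assumes "\<And>k. k \<in> set ks \<Longrightarrow> A k \<in> carrier_mat n (d k)"
  shows "hcat n (map A ks) \<in> carrier_mat n (\<Sum>k\<leftarrow>ks. d k)"
  using assms
proof (induction ks)
  case (Cons k ks)
  then show ?case using append_cols_carrier[of "A k" n "d k"] by (simp add: hcat_def)
qed (simp add: hcat_def)

text \<open>The width \<open>l\<close> is left arbitrary so that the induction can pass to the tail,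
  whose width is smaller.\<close>

lemma hcat_eq_0:
  assumes "\<And>k. k \<in> set ks \<Longrightarrow> A k \<in> carrier_mat n (d k)" "hcat n (map A ks) = 0\<^sub>m n l" "k \<in> set ks"
  shows "A k = 0\<^sub>m n (d k)"
  using assms
proof (induction ks arbitrary: l)
  case (Cons k' ks)
  have c: "hcat n (map A ks) \<in> carrier_mat n (\<Sum>k\<leftarrow>ks. d k)"
    by (rule hcat_carrier_sum) (use Cons in auto)
  have "append_cols (A k') (hcat n (map A ks)) = 0\<^sub>m n l" using Cons.prems by (simp add: hcat_def)
  from append_cols_eq_0[OF _ c this] Cons show ?case by auto
qed auto

lemma vcat_index:
  assumes "\<And>k. k < K \<Longrightarrow> A k \<in> carrier_mat n l" "k < K" "i < n" "j < l"
  shows "vcat l (map A [0..<K]) $$ (k * n + i, j) = A k $$ (i, j)"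
  using assms
proof (induction K arbitrary: A k)
  case (Suc K)
  have c: "vcat l (map (\<lambda>k. A (Suc k)) [0..<K]) \<in> carrier_mat (n * length (map (\<lambda>k. A (Suc k)) [0..<K])) l"
    by (rule vcat_carrier) (use Suc in auto)
  \<comment> \<open>\<open>vcat\<close> is a right fold, so the first block is split off; the
    remaining ones are reindexed by \<open>Suc\<close>, which is why the induction generalizes over
    \<open>A\<close>.\<close>
  have eq: "vcat l (map A [0..<Suc K]) = A 0 @\<^sub>r vcat l (map (\<lambda>k. A (Suc k)) [0..<K])"
    by (simp add: vcat_def map_upt_Suc del: upt_Suc)
  have A0: "A 0 \<in> carrier_mat n l" using Suc by auto
  note [simp] = carrier_matD[OF A0]
  show ?case
  proof (cases k)
    case 0
    then show ?thesis unfolding eq append_rows_def using A0 c Suc.prems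
      by (subst index_mat_four_block) auto
  next
    case (Suc k')
    have lt: "k' * n + i < n * K"
    proof -
      have "k' * n + i < (k' + 1) * n" using Suc.prems by simp
      also have "\<dots> \<le> K * n" using Suc.prems \<open>k = Suc k'\<close> by (intro mult_le_mono1) simp
      finally show ?thesis by (simp add: mult.commute)
    qed
    have "vcat l (map A [0..<Suc K]) $$ (k * n + i, j) = vcat l (map (\<lambda>k. A (Suc k)) [0..<K]) $$ (k' * n + i, j)"
      unfolding eq append_rows_def using A0 c Suc.prems \<open>k = Suc k'\<close> lt
      by (subst index_mat_four_block) auto
    also have "\<dots> = A k $$ (i, j)"
      using Suc.IH[of "\<lambda>k. A (Suc k)" k'] Suc.prems \<open>k = Suc k'\<close> by auto
    finally show ?thesis .
  qed
qed simp

text \<open>All equations together say that the stacked channel times \<open>D\<close> is the stack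
  of the targets \<open>T j\<close>. A right inverse of the stacked channel, applied to that stack,
  solves them simultaneously.\<close>

lemma full_row_rank_blockwise_solution:
  assumes H: "\<And>j. j < K \<Longrightarrow> H j c \<in> carrier_mat Nr L"
    and r: "vec_space.rank (K * Nr) (cluster_channel K L H c) = K * Nr"
    and T: "\<And>j. j < K \<Longrightarrow> T j \<in> carrier_mat Nr n"
  obtains D where "D \<in> carrier_mat L n" "\<And>j. j < K \<Longrightarrow> H j c * D = T j"
proof -
  let ?A = "cluster_channel K L H c" and ?T = "vcat n (map T [0..<K])"
  have "?A \<in> carrier_mat (Nr * length (map (\<lambda>k. H k c) [0..<K])) L"
    unfolding cluster_channel_def by (rule vcat_carrier) (use H in auto)
  then have A: "?A \<in> carrier_mat (K * Nr) L" by (simp add: mult.commute)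
  have "?T \<in> carrier_mat (Nr * length (map T [0..<K])) n"
    by (rule vcat_carrier) (use T in auto)
  then have Tc: "?T \<in> carrier_mat (K * Nr) n" by (simp add: mult.commute)
  obtain B where B: "B \<in> carrier_mat L (K * Nr)" "?A * B = 1\<^sub>m (K * Nr)"
    using full_row_rank_right_inverse[OF A r] by blast
  have D: "B * ?T \<in> carrier_mat L n" using B Tc by simp
  have AD: "?A * (B * ?T) = ?T"
    using assoc_mult_mat[OF A B(1) Tc] B(2) Tc by simp
  have "H j c * (B * ?T) = T j" if j: "j < K" for j
  proof (intro eq_matI)
    fix i b assume ib: "i < dim_row (T j)" "b < dim_col (T j)"
    then have i: "i < Nr" and b: "b < n" using T[OF j] by auto
    have lt: "j * Nr + i < K * Nr"
    proof -
      have "j * Nr + i < (j + 1) * Nr" using i by simp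
      also have "\<dots> \<le> K * Nr" using j by (intro mult_le_mono1) simp
      finally show ?thesis .
    qed
    \<comment> \<open>All blocks have \<open>Nr\<close> rows, so row \<open>i\<close> of block
      \<open>j\<close> is row \<open>j * Nr + i\<close> of the stack.\<close>
    have "row (H j c) i = row ?A (j * Nr + i)"
      using H[OF j] A lt i vcat_index[of K "\<lambda>j. H j c" Nr L j i] H j carrier_matD[OF H[OF j]]
      by (intro eq_vecI) (auto simp: cluster_channel_def)
    then have "(H j c * (B * ?T)) $$ (i, b) = (?A * (B * ?T)) $$ (j * Nr + i, b)"
      using H[OF j] A D lt i b by (auto simp del: assoc_mult_mat)
    also have "\<dots> = T j $$ (i, b)"
      unfolding AD using vcat_index[of K T Nr n j i b] T j i b by auto
    finally show "(H j c * (B * ?T)) $$ (i, b) = T j $$ (i, b)" .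
  qed (use H[OF j] T[OF j] D in auto)
  with D that show ?thesis by blast
qed

subsection \<open>Rates as functions of the received signals\<close>

text \<open>What user \<open>j\<close> receives of the signal meant for user \<open>m\<close>. For
  beamformers of the right dimensions, the rates depend on \<open>V\<close> only through these
  matrices.\<close>

definition received ::
  "nat \<Rightarrow> nat \<Rightarrow> (nat \<Rightarrow> nat) \<Rightarrow> (nat \<Rightarrow> nat \<Rightarrow> complex mat) \<Rightarrow> (nat \<Rightarrow> nat \<Rightarrow> complex mat) \<Rightarrow>
    nat \<Rightarrow> nat \<Rightarrow> complex mat" where
  "received C Nr d H V j m = user_channel C Nr H j * user_beam C d V m"

text \<open>Extends \<open>perturb\<close> from one entry to a whole block. The increment is a
  function on index pairs, matching the arguments that \<open>wdiff\<close> expects.\<close>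

definition shift_block ::
  "(nat \<Rightarrow> nat \<Rightarrow> complex mat) \<Rightarrow> nat \<Rightarrow> nat \<Rightarrow> (nat \<times> nat \<Rightarrow> complex) \<Rightarrow> (nat \<Rightarrow> nat \<Rightarrow> complex mat)" where
  "shift_block V k c X = V(k := (V k)(c := V k c + mat (dim_row (V k c)) (dim_col (V k c)) X))"

lemma perturb_eq_shift_block: "perturb V k c p z = shift_block V k c (\<lambda>q. if q = p then z else 0)"
proof -
  have "z \<cdot>\<^sub>m mat (dim_row (V k c)) (dim_col (V k c)) (\<lambda>q. if q = p then 1 else 0)
      = mat (dim_row (V k c)) (dim_col (V k c)) (\<lambda>q. if q = p then z else 0)"
    by (intro eq_matI) auto
  then show ?thesis unfolding perturb_def shift_block_def by simp
qed

context
  fixes K C L Nr :: nat and d :: "nat \<Rightarrow> nat" and \<sigma> :: "nat \<Rightarrow> real" and H :: "nat \<Rightarrow> nat \<Rightarrow> complex mat"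
  assumes H: "\<And>k c. k < K \<Longrightarrow> c < C \<Longrightarrow> H k c \<in> carrier_mat Nr L"
    and \<sigma>: "\<And>k. k < K \<Longrightarrow> (\<sigma> k)\<^sup>2 > 0"
begin

text \<open>Separates the contributions of the clusters, so that a change in one cluster affects a
  single summand.\<close>

lemma received_eq_mat_sum:
  assumes "j < K" "\<And>c. c < C \<Longrightarrow> V m c \<in> carrier_mat L (d m)"
  shows "received C Nr d H V j m = mat_sum Nr (d m) (\<lambda>c. H j c * V m c) {..<C}"
  using hcat_mult_vcat[of "[0..<C]" "\<lambda>c. H j c" Nr L "\<lambda>c. V m c" "d m"] H assms
  unfolding received_def user_channel_def user_beam_def by (simp add: atLeast0LessThan)

lemma received_carrier:
  assumes "j < K" "\<And>c. c < C \<Longrightarrow> V m c \<in> carrier_mat L (d m)"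
  shows "received C Nr d H V j m \<in> carrier_mat Nr (d m)"
  using received_eq_mat_sum[of j V m] assms by (simp add: mat_sum_def)

lemma interference_eq_received:
  assumes V: "\<And>k c. k < K \<Longrightarrow> c < C \<Longrightarrow> V k c \<in> carrier_mat L (d k)" and k: "k < K"
  shows "interference K C Nr d \<sigma> H V k = complex_of_real ((\<sigma> k)\<^sup>2) \<cdot>\<^sub>m 1\<^sub>m Nr +
    mat_sum Nr Nr (\<lambda>j. received C Nr d H V k j * mat_adjoint (received C Nr d H V k j)) ({..<K} - {k})"
proof -
  have Hk: "user_channel C Nr H k \<in> carrier_mat Nr (L * C)"
    using H k by (intro user_channel_carrier) auto
  have "user_channel C Nr H k * user_beam C d V j * mat_adjoint (user_beam C d V j) * mat_adjoint (user_channel C Nr H k)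
      = received C Nr d H V k j * mat_adjoint (received C Nr d H V k j)" if "j < K" for j
  proof -
    have B: "user_beam C d V j \<in> carrier_mat (L * C) (d j)"
      using V that by (intro user_beam_carrier) auto
    show ?thesis unfolding received_def mat_adjoint_mult[OF Hk B]
      by (rule assoc_mult_mat[OF mult_carrier_mat[OF Hk B] mat_adjoint_carrier[OF B] mat_adjoint_carrier[OF Hk]])
  qed
  then show ?thesis unfolding interference_def
    by (auto simp: mat_sum_def intro!: arg_cong2[where f = "(+)"] eq_matI sum.cong)
qed

text \<open>Each interference term is a received matrix times its adjoint, hence positive
  semidefinite, and the noise term makes the sum nonsingular.\<close>

lemma psd_mat_interference:
  assumes V: "\<And>k c. k < K \<Longrightarrow> c < C \<Longrightarrow> V k c \<in> carrier_mat L (d k)" and k: "k < K"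
  shows "psd_mat Nr (interference K C Nr d \<sigma> H V k)" "det (interference K C Nr d \<sigma> H V k) \<noteq> 0"
proof -
  have "psd_mat Nr (mat_sum Nr Nr (\<lambda>j. received C Nr d H V k j * mat_adjoint (received C Nr d H V k j)) ({..<K} - {k}))"
  proof (rule psd_mat_mat_sum)
    fix j assume "j \<in> {..<K} - {k}"
    then have "received C Nr d H V k j \<in> carrier_mat Nr (d j)" using V k by (intro received_carrier) auto
    then show "psd_mat Nr (received C Nr d H V k j * mat_adjoint (received C Nr d H V k j))"
      by (rule psd_mat_mult_adjoint)
  qed
  from psd_mat_shift[OF this \<sigma>[OF k]]
  show "psd_mat Nr (interference K C Nr d \<sigma> H V k)" "det (interference K C Nr d \<sigma> H V k) \<noteq> 0"
    using interference_eq_received[of V k] V k by simp_all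
qed

text \<open>The signal-to-interference-plus-noise matrix \<open>G^H F^{-1} G\<close> of user
  \<open>k\<close>, with \<open>G\<close> the received own signal and \<open>F\<close> the
  interference-plus-noise matrix.\<close>

definition snr where
  "snr V k = mat_adjoint (received C Nr d H V k k) * the (mat_inverse (interference K C Nr d \<sigma> H V k)) *
     received C Nr d H V k k"

text \<open>Regrouping the factors of the rate around \<open>G = H_k V_k\<close> exhibits a
  congruence of the inverse of a positive semidefinite matrix.\<close>

lemma
  assumes V: "\<And>k c. k < K \<Longrightarrow> c < C \<Longrightarrow> V k c \<in> carrier_mat L (d k)" and k: "k < K"
  shows rate_eq_snr: "rate K C Nr d \<sigma> H V k = ln (Re (det (1\<^sub>m (d k) + snr V k)))"
    and psd_mat_snr: "psd_mat (d k) (snr V k)"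
proof -
  let ?F = "interference K C Nr d \<sigma> H V k"
  let ?X = "the (mat_inverse ?F)" and ?H = "user_channel C Nr H k" and ?B = "user_beam C d V k"
  have F: "psd_mat Nr ?F" "?F \<in> carrier_mat Nr Nr" "det ?F \<noteq> 0"
    using psd_mat_interference[of V k] V k unfolding psd_mat_def by auto
  have X: "?X \<in> carrier_mat Nr Nr" "?F * ?X = 1\<^sub>m Nr"
    unfolding mat_inverse_eq_adj_mat[OF F(2,3)]
    using adj_mat[OF F(2)] F(3) by (auto simp: mult_smult_distrib[OF F(2)] intro!: eq_matI)
  have G: "received C Nr d H V k k \<in> carrier_mat Nr (d k)" using V k by (intro received_carrier) auto
  show "psd_mat (d k) (snr V k)"
    unfolding snr_def by (rule psd_mat_congruence_inverse[OF F(1) X G])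
  have Hk: "?H \<in> carrier_mat Nr (L * C)"
    using H k by (intro user_channel_carrier) auto
  have B: "?B \<in> carrier_mat (L * C) (d k)"
    using V k by (intro user_beam_carrier) auto
  note c = mat_adjoint_carrier[OF B] mat_adjoint_carrier[OF Hk] 
  have "mat_adjoint ?B * mat_adjoint ?H * ?X * ?H * ?B = snr V k"
    unfolding snr_def received_def mat_adjoint_mult[OF Hk B]
    by (rule assoc_mult_mat[OF mult_carrier_mat[OF mult_carrier_mat[OF c] X(1)] Hk B])
  then show "rate K C Nr d \<sigma> H V k = ln (Re (det (1\<^sub>m (d k) + snr V k)))"
    unfolding rate_def by simp
qed

section \<open>Perturbing a single beamformer block\<close>

context
  fixes V :: "nat \<Rightarrow> nat \<Rightarrow> complex mat" and k c :: nat
  assumes V: "\<And>k c. k < K \<Longrightarrow> c < C \<Longrightarrow> V k c \<in> carrier_mat L (d k)" and k: "k < K" and c: "c < C"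
begin

lemma shift_block_carrier:
  "k' < K \<Longrightarrow> c' < C \<Longrightarrow> shift_block V k c X k' c' \<in> carrier_mat L (d k')"
  using V[of k' c'] V[OF k c] unfolding shift_block_def by auto

text \<open>The block \<open>V k c\<close> enters the signal of user \<open>k\<close> linearly and
  only through the channel block \<open>H j c\<close>.\<close>

lemma received_shift_block:
  assumes j: "j < K" and m: "m < K"
  shows "received C Nr d H (shift_block V k c X) j m =
    (if m = k then received C Nr d H V j k + H j c * mat L (d k) X else received C Nr d H V j m)"
proof (cases "m = k")
  case False
  then show ?thesis by (simp add: received_def user_beam_def shift_block_def)
next
  case True
  let ?M = "mat L (d k) X" and ?W = "shift_block V k c X"
  have W: "?W k c' = (if c' = c then V k c + ?M else V k c')" for c'
    using V[OF k c] unfolding shift_block_def by auto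
  have "received C Nr d H ?W j k = mat_sum Nr (d k) (\<lambda>c'. H j c' * ?W k c') {..<C}"
    using shift_block_carrier[OF k] by (intro received_eq_mat_sum j)
  also have "\<dots> = mat_sum Nr (d k) (\<lambda>c'. H j c' * V k c') {..<C} + H j c * ?M"
  proof (intro eq_matI)
    fix a b assume "a < dim_row (mat_sum Nr (d k) (\<lambda>c'. H j c' * V k c') {..<C} + H j c * ?M)"
      "b < dim_col (mat_sum Nr (d k) (\<lambda>c'. H j c' * V k c') {..<C} + H j c * ?M)"
    then have a: "a < Nr" and b: "b < d k" using H[OF j c] by auto
    have "(\<Sum>c'<C. (H j c' * ?W k c') $$ (a, b)) =
        (\<Sum>c'<C. (H j c' * V k c') $$ (a, b) + (if c' = c then (H j c * ?M) $$ (a, b) else 0))"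
    proof (intro sum.cong refl)
      fix c' assume "c' \<in> {..<C}"
      then have "c' < C" by simp
      have "H j c * (V k c + ?M) = H j c * V k c + H j c * ?M"
        using mult_add_distrib_mat[OF H[OF j c] V[OF k c], of ?M] by simp
      then show "(H j c' * ?W k c') $$ (a, b) =
          (H j c' * V k c') $$ (a, b) + (if c' = c then (H j c * ?M) $$ (a, b) else 0)"
        unfolding W using a b H[OF j c] V[OF k c] by (auto simp del: index_mult_mat(1))
    qed
    also have "\<dots> = (\<Sum>c'<C. (H j c' * V k c') $$ (a, b)) + (H j c * ?M) $$ (a, b)"
      using c by (simp add: sum.distrib del: index_mult_mat(1))
    finally show "mat_sum Nr (d k) (\<lambda>c'. H j c' * ?W k c') {..<C} $$ (a, b) =
      (mat_sum Nr (d k) (\<lambda>c'. H j c' * V k c') {..<C} + H j c * ?M) $$ (a, b)"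
      using a b H[OF j c] by (simp add: mat_sum_def del: index_mult_mat(1))
  qed (use H[OF j c] in \<open>auto simp: mat_sum_def\<close>)
  also have "mat_sum Nr (d k) (\<lambda>c'. H j c' * V k c') {..<C} = received C Nr d H V j k"
    using V[OF k] by (intro received_eq_mat_sum[symmetric] j)
  finally show ?thesis using True by simp
qed

lemma wdiff_mat_received:
  assumes j: "j < K" and m: "m < K"
  shows "wdiff_mat ({..<L} \<times> {..<d k}) Nr (d m) (\<lambda>X. received C Nr d H (shift_block V k c X) j m)"
proof (cases "m = k")
  case True
  have "wdiff_mat ({..<L} \<times> {..<d k}) L (d k) (\<lambda>X. mat L (d k) X)"
    unfolding wdiff_mat_def by (auto intro!: wdiff_coord)
  moreover have "received C Nr d H V j k \<in> carrier_mat Nr (d k)"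
    using V j k by (intro received_carrier) auto
  ultimately show ?thesis
    unfolding received_shift_block[OF j m] using True H[OF j c]
    by (auto intro!: wdiff_mat_add wdiff_mat_mult wdiff_mat_const)
next
  case False
  have "received C Nr d H V j m \<in> carrier_mat Nr (d m)"
    using V j m by (intro received_carrier) auto
  then show ?thesis unfolding received_shift_block[OF j m] using False by (simp add: wdiff_mat_const)
qed

text \<open>Differentiability passes from the received signals to the interference, its inverse,
  \<open>snr\<close>, the determinant and its logarithm. Positive semidefiniteness keeps the
  inverted determinant nonzero and the argument of \<open>ln\<close> positive.\<close>

lemma wdiff_rate:
  assumes j: "j < K"
  shows "wdiff ({..<L} \<times> {..<d k}) (\<lambda>X. of_real (rate K C Nr d \<sigma> H (shift_block V k c X) j))"
proof -
  let ?I = "{..<L} \<times> {..<d k}" and ?W = "\<lambda>X. shift_block V k c X"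
  have W: "\<And>k' c'. k' < K \<Longrightarrow> c' < C \<Longrightarrow> ?W X k' c' \<in> carrier_mat L (d k')" for X
    by (rule shift_block_carrier)
  have "wdiff_mat ?I Nr Nr (\<lambda>X. interference K C Nr d \<sigma> H (?W X) j)"
  proof -
    have "interference K C Nr d \<sigma> H (?W X) j = complex_of_real ((\<sigma> j)\<^sup>2) \<cdot>\<^sub>m 1\<^sub>m Nr +
      mat_sum Nr Nr (\<lambda>m. received C Nr d H (?W X) j m * mat_adjoint (received C Nr d H (?W X) j m)) ({..<K} - {j})" for X
      using W j by (intro interference_eq_received) auto
    moreover have "wdiff_mat ?I Nr Nr (\<lambda>X. received C Nr d H (?W X) j m * mat_adjoint (received C Nr d H (?W X) j m))"
      if "m < K" for m
      by (rule wdiff_mat_mult[OF wdiff_mat_received[OF j that] wdiff_mat_adjoint[OF wdiff_mat_received[OF j that]]])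
    ultimately show ?thesis
      by (simp only:) (intro wdiff_mat_add wdiff_mat_const wdiff_mat_sum; simp)
  qed
  then have "wdiff_mat ?I Nr Nr (\<lambda>X. the (mat_inverse (interference K C Nr d \<sigma> H (?W X) j)))"
    by (rule wdiff_mat_inverse) (rule psd_mat_interference(2)[OF W j])
  then have "wdiff_mat ?I (d j) (d j) (\<lambda>X. 1\<^sub>m (d j) + snr (?W X) j)"
    unfolding snr_def
    by (intro wdiff_mat_add[OF wdiff_mat_const[OF one_carrier_mat]]
        wdiff_mat_mult[OF wdiff_mat_mult[OF wdiff_mat_adjoint[OF wdiff_mat_received[OF j j]]] wdiff_mat_received[OF j j]])
  then have "wdiff ?I (\<lambda>X. of_real (ln (Re (det (1\<^sub>m (d j) + snr (?W X) j)))))"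
    by (rule wdiff_ln_Re[OF wdiff_mat_det psd_mat_det_one_plus_pos[OF psd_mat_snr[OF W j]]])
  moreover have "rate K C Nr d \<sigma> H (?W X) j = ln (Re (det (1\<^sub>m (d j) + snr (?W X) j)))" for X
    by (rule rate_eq_snr[OF W j])
  ultimately show ?thesis by (simp only:)
qed

lemma rate_shift_block_cong:
  assumes j: "j < K"
    and M: "\<And>m. m < K \<Longrightarrow> received C Nr d H (shift_block V k c X) j m = received C Nr d H V j m"
  shows "rate K C Nr d \<sigma> H (shift_block V k c X) j = rate K C Nr d \<sigma> H V j"
proof -
  have "mat_sum Nr Nr (\<lambda>m. received C Nr d H (shift_block V k c X) j m *
        mat_adjoint (received C Nr d H (shift_block V k c X) j m)) ({..<K} - {j}) =
      mat_sum Nr Nr (\<lambda>m. received C Nr d H V j m * mat_adjoint (received C Nr d H V j m)) ({..<K} - {j})"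
    unfolding mat_sum_def using M by (intro eq_matI) auto
  then have "interference K C Nr d \<sigma> H (shift_block V k c X) j = interference K C Nr d \<sigma> H V j"
    using V j shift_block_carrier by (simp add: interference_eq_received)
  then show ?thesis
    using V j shift_block_carrier M[OF j] by (simp add: rate_eq_snr snr_def)
qed

text \<open>
  The direction is chosen such that user \<open>k\<close> receives its own signal amplified by the factor
  \<open>1 + t\<close> while all other received signals, hence all interference matrices, are unchanged.
\<close>

lemma weighted_sum_rate_not_critical:
  assumes \<omega>: "\<omega> k > 0" and r: "rate K C Nr d \<sigma> H V k \<noteq> 0"
    and rank: "vec_space.rank (K * Nr) (cluster_channel K L H c) = K * Nr"
  obtains X D where "D > 0"
    "((\<lambda>t. weighted_sum_rate K C Nr d \<omega> \<sigma> H (shift_block V k c (\<lambda>p. of_real t * X p))) has_real_derivative D) (at 0)"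
proof -
  let ?G = "received C Nr d H V k k"
  have G: "?G \<in> carrier_mat Nr (d k)" using V k by (intro received_carrier) auto
  obtain \<Delta> where \<Delta>: "\<Delta> \<in> carrier_mat L (d k)"
    "\<And>j. j < K \<Longrightarrow> H j c * \<Delta> = (if j = k then ?G else 0\<^sub>m Nr (d k))"
  proof (rule full_row_rank_blockwise_solution[OF _ rank])
    show "j < K \<Longrightarrow> H j c \<in> carrier_mat Nr L" for j using H c by blast
    show "j < K \<Longrightarrow> (if j = k then ?G else 0\<^sub>m Nr (d k)) \<in> carrier_mat Nr (d k)" for j using G by simp
  qed blast
  define W where "W t = shift_block V k c (\<lambda>p. of_real t * \<Delta> $$ p)" for t :: real
  have Wc: "\<And>k' c'. k' < K \<Longrightarrow> c' < C \<Longrightarrow> W t k' c' \<in> carrier_mat L (d k')" for t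
    unfolding W_def by (rule shift_block_carrier)
  have M: "mat L (d k) (\<lambda>p. of_real t * \<Delta> $$ p) = of_real t \<cdot>\<^sub>m \<Delta>" for t :: real
    using \<Delta>(1) by (intro eq_matI) auto
  have rW: "received C Nr d H (W t) j m =
      (if m = k \<and> j = k then of_real (1 + t) \<cdot>\<^sub>m ?G else received C Nr d H V j m)" if "j < K" "m < K" for t j m
  proof -
    have "received C Nr d H V j k + 0\<^sub>m Nr (d k) = received C Nr d H V j k"
      using received_carrier[of j V k] V k that by simp
    moreover have "?G + of_real t \<cdot>\<^sub>m ?G = of_real (1 + t) \<cdot>\<^sub>m ?G"
      using G by (intro eq_matI) (auto simp: algebra_simps)
    moreover have "H j c * (of_real t \<cdot>\<^sub>m \<Delta>) = of_real t \<cdot>\<^sub>m (H j c * \<Delta>)"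
      by (rule mult_smult_distrib[OF H[OF that(1) c] \<Delta>(1)])
    moreover have "complex_of_real t \<cdot>\<^sub>m 0\<^sub>m Nr (d k) = 0\<^sub>m Nr (d k)" by (intro eq_matI) auto
    ultimately show ?thesis
      unfolding W_def received_shift_block[OF that] M using \<Delta>(2)[OF that(1)] by auto
  qed
  have other: "rate K C Nr d \<sigma> H (W t) j = rate K C Nr d \<sigma> H V j" if "j < K" "j \<noteq> k" for t j
    using rate_shift_block_cong[OF that(1)] rW[OF that(1)] that(2) unfolding W_def by simp
  have "interference K C Nr d \<sigma> H (W t) k = interference K C Nr d \<sigma> H V k" for t
  proof -
    have "mat_sum Nr Nr (\<lambda>m. received C Nr d H (W t) k m * mat_adjoint (received C Nr d H (W t) k m)) ({..<K} - {k}) =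
      mat_sum Nr Nr (\<lambda>m. received C Nr d H V k m * mat_adjoint (received C Nr d H V k m)) ({..<K} - {k})"
      unfolding mat_sum_def using rW[OF k] by (intro eq_matI) auto
    then show ?thesis using V k Wc by (simp add: interference_eq_received)
  qed
  \<comment> \<open>With the interference fixed, \<open>snr\<close> is quadratic in the received own
    signal; its factor \<open>1 + t\<close> is real, so the adjoint contributes the same
    factor.\<close>
  then have "snr (W t) k = of_real ((1 + t)\<^sup>2) \<cdot>\<^sub>m snr V k" for t
  proof -
    let ?X = "the (mat_inverse (interference K C Nr d \<sigma> H V k))" and ?s = "complex_of_real (1 + t)"
    have "interference K C Nr d \<sigma> H V k \<in> carrier_mat Nr Nr" "det (interference K C Nr d \<sigma> H V k) \<noteq> 0"
      using psd_mat_interference[of V k] V k unfolding psd_mat_def by auto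
    then have X: "?X \<in> carrier_mat Nr Nr" by (simp add: mat_inverse_eq_adj_mat adj_mat)
    note G' = mat_adjoint_carrier[OF G]
    have "snr (W t) k = (?s \<cdot>\<^sub>m mat_adjoint ?G) * ?X * (?s \<cdot>\<^sub>m ?G)"
      using \<open>\<And>t. interference K C Nr d \<sigma> H (W t) k = _\<close> rW[OF k k]
      unfolding snr_def by (simp add: mat_adjoint_smult)
    also have "\<dots> = ?s \<cdot>\<^sub>m (?s \<cdot>\<^sub>m (mat_adjoint ?G * ?X * ?G))"
      unfolding mult_smult_assoc_mat[OF G' X]
      by (subst mult_smult_distrib[OF _ G, of _ "d k"]; (subst mult_smult_assoc_mat[OF mult_carrier_mat[OF G' X] G])?)
        (use G' X in auto)
    also have "\<dots> = of_real ((1 + t)\<^sup>2) \<cdot>\<^sub>m snr V k"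
      unfolding snr_def by (intro eq_matI) (auto simp: power2_eq_square mult.assoc)
    finally show ?thesis .
  qed
  then have self: "rate K C Nr d \<sigma> H (W t) k = ln (Re (det (1\<^sub>m (d k) + of_real ((1 + t)\<^sup>2) \<cdot>\<^sub>m snr V k)))" for t
    using rate_eq_snr[OF Wc k] by simp
  have "ln (Re (det (1\<^sub>m (d k) + snr V k))) \<noteq> 0"
    using r rate_eq_snr[of V k] V k by simp
  from psd_mat_ln_det_derivative[OF psd_mat_snr[OF V k] this]
  obtain D where D: "D > 0" "((\<lambda>t. rate K C Nr d \<sigma> H (W t) k) has_real_derivative D) (at 0)"
    unfolding self by blast
  \<comment> \<open>The rates of all other users are constant in \<open>t\<close>, so only the
    summand of user \<open>k\<close> has a nonzero derivative.\<close>
  have "((\<lambda>t. \<Sum>j<K. \<omega> j * rate K C Nr d \<sigma> H (W t) j) has_real_derivative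
      (\<Sum>j<K. \<omega> j * (if j = k then D else 0))) (at 0)"
  proof (intro DERIV_sum DERIV_cmult)
    fix j assume "j \<in> {..<K}"
    then show "((\<lambda>t. rate K C Nr d \<sigma> H (W t) j) has_real_derivative (if j = k then D else 0)) (at 0)"
      using D(2) other[of j] by auto
  qed
  moreover have "(\<Sum>j<K. \<omega> j * (if j = k then D else 0)) = \<omega> k * D"
    using k by (simp add: if_distrib[of "(*) _"] cong: if_cong)
  ultimately show ?thesis
    using that[of "\<omega> k * D" "\<lambda>p. \<Delta> $$ p"] D(1) \<omega> unfolding W_def weighted_sum_rate_def by simp
qed

text \<open>If the block vanished, so would all partial derivatives and, by
  \<open>wdiff_real_critical\<close>, every directional derivative, against
  \<open>weighted_sum_rate_not_critical\<close>.\<close>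

lemma wirtinger_block_nonzero:
  assumes \<omega>: "\<omega> k > 0" and r: "rate K C Nr d \<sigma> H V k \<noteq> 0"
    and rank: "vec_space.rank (K * Nr) (cluster_channel K L H c) = K * Nr"
  shows "wirtinger_block (\<lambda>W. - weighted_sum_rate K C Nr d \<omega> \<sigma> H W) V k c \<noteq> 0\<^sub>m L (d k)"
proof
  let ?f = "\<lambda>W. - weighted_sum_rate K C Nr d \<omega> \<sigma> H W" and ?I = "{..<L} \<times> {..<d k}"
  assume z: "wirtinger_block ?f V k c = 0\<^sub>m L (d k)"
  obtain X D where D: "D > 0"
    "((\<lambda>t. weighted_sum_rate K C Nr d \<omega> \<sigma> H (shift_block V k c (\<lambda>p. of_real t * X p))) has_real_derivative D) (at 0)"
    using weighted_sum_rate_not_critical[of \<omega>, OF \<omega> r rank] by blast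
  have "((\<lambda>t. ?f (shift_block V k c (\<lambda>p. of_real t * X p))) has_real_derivative 0) (at 0)"
  proof (rule wdiff_real_critical[of ?I "\<lambda>X. ?f (shift_block V k c X)"])
    have "wdiff ?I (\<lambda>X. \<Sum>j<K. of_real (- \<omega> j) * of_real (rate K C Nr d \<sigma> H (shift_block V k c X) j))"
      by (intro wdiff_sum wdiff_mult wdiff_const wdiff_rate) auto
    then show "wdiff ?I (\<lambda>X. of_real (?f (shift_block V k c X)))"
      by (simp add: weighted_sum_rate_def sum_negf)
    fix p assume p: "p \<in> ?I"
    then obtain a b where ab: "p = (a, b)" "a < L" "b < d k" by auto
    have "wirtinger_block ?f V k c $$ (a, b) = 0" unfolding z using ab by simp
    \<comment> \<open>The real and imaginary parts of a Wirtinger entry are half the derivatives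
      along the real and imaginary axes, so both of these vanish.\<close>
    then have
      "deriv (\<lambda>t. ?f (perturb V k c p (of_real t))) 0 = 0"
      "deriv (\<lambda>t. ?f (perturb V k c p (\<i> * of_real t))) 0 = 0"
      using ab carrier_matD[OF V[OF k c]] unfolding wirtinger_block_def by (auto simp: complex_eq_iff)
    then show "deriv (\<lambda>t. ?f (shift_block V k c (\<lambda>i. if i = p then of_real t else 0))) 0 = 0"
      "deriv (\<lambda>t. ?f (shift_block V k c (\<lambda>i. if i = p then \<i> * of_real t else 0))) 0 = 0"
      unfolding perturb_eq_shift_block by blast+
  qed simp
  moreover have "((\<lambda>t. ?f (shift_block V k c (\<lambda>p. of_real t * X p))) has_real_derivative - D) (at 0)"
    using D(2) by (rule DERIV_minus)
  ultimately have "0 = - D" by (rule DERIV_unique)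
  with D(1) show False by simp
qed

end

end

section \<open>Zero multipliers and tightness of the constraints\<close>

lemma cluster_gradient_zero_imp_block_zero:
  assumes V: "\<And>k. k < K \<Longrightarrow> V k c \<in> carrier_mat L (d k)"
    and eq: "wirtinger_gradient K L f V c + 0 \<cdot>\<^sub>m cluster_beam K L V c = 0\<^sub>m L (\<Sum>k<K. d k)"
    and k: "k < K"
  shows "wirtinger_block f V k c = 0\<^sub>m L (d k)"
proof -
  have B: "wirtinger_block f V k c \<in> carrier_mat L (d k)" if "k < K" for k
    using V[OF that] unfolding wirtinger_block_def by auto
  have sl: "(\<Sum>k\<leftarrow>[0..<K]. d k) = (\<Sum>k<K. d k)"
    by (simp add: sum_list_distinct_conv_sum_set atLeast0LessThan)
  have "wirtinger_gradient K L f V c \<in> carrier_mat L (\<Sum>k<K. d k)"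
    unfolding wirtinger_gradient_def sl[symmetric] by (rule hcat_carrier_sum) (use B in auto)
  moreover have "cluster_beam K L V c \<in> carrier_mat L (\<Sum>k<K. d k)"
    unfolding cluster_beam_def sl[symmetric] by (rule hcat_carrier_sum) (use V in auto)
  ultimately have "wirtinger_gradient K L f V c + 0 \<cdot>\<^sub>m cluster_beam K L V c = wirtinger_gradient K L f V c"
    by (intro eq_matI) auto
  then have "hcat L (map (\<lambda>k. wirtinger_block f V k c) [0..<K]) = 0\<^sub>m L (\<Sum>k<K. d k)"
    using eq unfolding wirtinger_gradient_def by simp
  then show ?thesis
    by (rule hcat_eq_0[where d = d and ks = "[0..<K]", rotated]) (use B k in auto)
qed

text \<open>The nonzero weighted sum rate excludes the zero beamformer, which is stationary with all
  constraints slack by \<open>zero_beamformer_stationary_not_tight\<close>.\<close>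

theorem proposition1:
  fixes K C L Nr :: nat
    and d :: "nat \<Rightarrow> nat"
    and \<omega> \<sigma> P :: "nat \<Rightarrow> real"
    and H V :: "nat \<Rightarrow> nat \<Rightarrow> complex mat"
  assumes "K > 0" and "C > 0" and "L > 0" and "Nr > 0"
    and "\<And>k. k < K \<Longrightarrow> 0 < d k \<and> d k \<le> min (L * C) Nr"
    and "\<And>k. k < K \<Longrightarrow> \<omega> k > 0"
    and "\<And>k. k < K \<Longrightarrow> (\<sigma> k)\<^sup>2 > 0"
    and "\<And>c. c < C \<Longrightarrow> P c > 0"
    and "\<And>k c. k < K \<Longrightarrow> c < C \<Longrightarrow> H k c \<in> carrier_mat Nr L"
    and "\<And>c. c < C \<Longrightarrow> vec_space.rank (K * Nr) (cluster_channel K L H c) = K * Nr"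
    and "\<And>k c. k < K \<Longrightarrow> c < C \<Longrightarrow> V k c \<in> carrier_mat L (d k)"
    and "stationary_point K C L Nr d \<omega> \<sigma> P H V"
    and "weighted_sum_rate K C Nr d \<omega> \<sigma> H V \<noteq> 0"
  shows "\<forall>c<C. frob_norm_sq (cluster_beam K L V c) = P c"
proof (intro allI impI, rule ccontr)
  fix c assume c: "c < C" and slack: "frob_norm_sq (cluster_beam K L V c) \<noteq> P c"
  let ?f = "\<lambda>W. - weighted_sum_rate K C Nr d \<omega> \<sigma> H W"
  obtain \<mu> :: "nat \<Rightarrow> real" where
    "wirtinger_gradient K L ?f V c + complex_of_real (\<mu> c) \<cdot>\<^sub>m cluster_beam K L V c = 0\<^sub>m L (\<Sum>k<K. d k)"
    "\<mu> c * (frob_norm_sq (cluster_beam K L V c) - P c) = 0"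
    using assms(12) c unfolding stationary_point_def by blast
  \<comment> \<open>Complementary slackness: the factor \<open>frob_norm_sq ... - P c\<close> is
    nonzero, so \<open>\<mu> c = 0\<close>.\<close>
  then have grad: "wirtinger_gradient K L ?f V c + 0 \<cdot>\<^sub>m cluster_beam K L V c = 0\<^sub>m L (\<Sum>k<K. d k)"
    using slack by simp
  have "\<exists>k<K. rate K C Nr d \<sigma> H V k \<noteq> 0"
    using assms(13) unfolding weighted_sum_rate_def by (metis (no_types, lifting) lessThan_iff mult_zero_right sum.neutral)
  then obtain k where k: "k < K" "rate K C Nr d \<sigma> H V k \<noteq> 0" by blast
  have "wirtinger_block ?f V k c \<noteq> 0\<^sub>m L (d k)"
    by (rule wirtinger_block_nonzero[where C = C and V = V and H = H]) (use assms k c in auto)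
  moreover have "wirtinger_block ?f V k c = 0\<^sub>m L (d k)"
    using assms(11) c by (intro cluster_gradient_zero_imp_block_zero[OF _ grad k(1)]) auto
  ultimately show False by blast
qed

end
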